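(* Let $\mathcal{H},\mathcal{K}$ be Hilbert spaces, let $J\subseteq\mathbb{R}$ be an interval, and let $f:J\to\mathbb{R}$ be a monotone convex function. For each $s\in J$ let $C_s$ be a real number such that $C_s(t-s)+f(s)\le f(t)$ for all $t\in J$. Let $A_1,\ldots,A_n\in\mathcal{B}(\mathcal{H})$ be self-adjoint operators with spectra in $J$, and let $\Phi_1,\ldots,\Phi_n:\mathcal{B}(\mathcal{H})\to\mathcal{B}(\mathcal{K})$ be positive linear mappings such that $\sum_{i=1}^n\Phi_i(\mathbf{1}_{\mathcal{H}})=\mathbf{1}_{\mathcal{K}}$. Then $$f\left(\sum_{i=1}^n\Phi_i(A_i)\right)\le\sum_{i=1}^n\Phi_i(f(A_i))+\zeta\,\mathbf{1}_{\mathcal{K}},$$ where, writing $S=\sum_{i=1}^n\Phi_i(A_i)$, $$\zeta=\sup\left\{\left\langle C_{S}\,S x,x\right\rangle-\left\langle S x,x\right\rangle\left\langle C_{S}x,x\right\rangle:\ x\in\mathcal{K},\ \|x\|=1\right\}.$$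
   Context: Hilbert spaces are complex. $\mathcal{B}(\mathcal{H})$ is the $C^*$-algebra of all bounded linear operators on $\mathcal{H}$, and $\mathbf{1}_{\mathcal{H}}$ is the identity operator. A self-adjoint operator $A$ is positive ($A\ge 0$) if $\langle Ax,x\rangle\ge 0$ for all $x$; for self-adjoint $A,B$, $A\le B$ means $B-A\ge 0$. A linear map $\Phi:\mathcal{B}(\mathcal{H})\to\mathcal{B}(\mathcal{K})$ is positive if $\Phi(A)\ge 0$ whenever $A\ge 0$. For a self-adjoint operator $A$ with spectrum in $J$, $f(A)$ is defined by functional calculus, and $C_A$ denotes the operator obtained by applying the function $s\mapsto C_s$ to $A$ by (bounded Borel) functional calculus; the function $s\mapsto C_s$ is automatically nondecreasing on $J$, hence Borel and bounded on compact subsets of $J$. The convexity of $f$ is ordinary (scalar) convexity; operator convexity is not assumed. *)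

theory Defs
  imports "HOL-Analysis.Analysis"
begin

section \<open>Complex Hilbert spaces\<close>

class complex_vector = ab_group_add +
  fixes scaleC :: "complex \<Rightarrow> 'a \<Rightarrow> 'a"  (infixr \<open>*\<^sub>C\<close> 75)
  assumes scaleC_add_right: "a *\<^sub>C (x + y) = a *\<^sub>C x + a *\<^sub>C y"
    and scaleC_add_left: "(a + b) *\<^sub>C x = a *\<^sub>C x + b *\<^sub>C x"
    and scaleC_scaleC: "a *\<^sub>C b *\<^sub>C x = (a * b) *\<^sub>C x"
    and scaleC_one: "1 *\<^sub>C x = x"

text \<open>The inner product is linear in its first argument.  The last axiom makes the given
  norm the norm of the inner product.\<close>

class complex_inner = complex_vector + real_normed_vector +
  fixes cinner :: "'a \<Rightarrow> 'a \<Rightarrow> complex"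
  assumes scaleR_scaleC: "r *\<^sub>R x = complex_of_real r *\<^sub>C x"
    and cinner_commute: "cinner x y = cnj (cinner y x)"
    and cinner_add_left: "cinner (x + y) z = cinner x z + cinner y z"
    and cinner_scaleC_left: "cinner (c *\<^sub>C x) y = c * cinner x y"
    and cinner_self: "cinner x x = complex_of_real ((norm x)\<^sup>2)"

class complex_hilbert = complex_inner + complete_space

instantiation complex :: complex_hilbert
begin
definition scaleC_complex :: "complex \<Rightarrow> complex \<Rightarrow> complex" where
  "scaleC_complex c z = c * z"
definition cinner_complex :: "complex \<Rightarrow> complex \<Rightarrow> complex" where
  "cinner_complex z w = z * cnj w"
instance
  by standard
    (simp_all add: scaleC_complex_def cinner_complex_def algebra_simps scaleR_conv_of_real
      complex_norm_square del: of_real_power)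
end

definition clinear :: "('a::complex_vector \<Rightarrow> 'b::complex_vector) \<Rightarrow> bool" where
  "clinear f \<longleftrightarrow> (\<forall>x y. f (x + y) = f x + f y) \<and> (\<forall>c x. f (c *\<^sub>C x) = c *\<^sub>C f x)"

section \<open>The algebra of bounded operators\<close>

typedef (overloaded) 'a bop =
  "{f :: 'a::complex_inner \<Rightarrow> 'a. clinear f \<and> (\<exists>K. \<forall>x. norm (f x) \<le> K * norm x)}"
  morphisms bop_apply Bop
proof (intro exI[of _ "\<lambda>x. 0"] CollectI conjI)
  have "c *\<^sub>C (0::'a) = 0" for c
    using scaleC_add_right[of c "0::'a" 0] by simp
  then show "clinear (\<lambda>x::'a. 0::'a)"
    by (simp add: clinear_def)
  show "\<exists>K. \<forall>x::'a. norm (0::'a) \<le> K * norm x"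
    by (rule exI[of _ 0]) simp
qed

setup_lifting type_definition_bop

notation bop_apply (infixr \<open>*\<^sub>V\<close> 70)

lemma bop_eqI: "(\<And>x. A *\<^sub>V x = B *\<^sub>V x) \<Longrightarrow> A = B"
  by transfer auto

lemma scaleC_zero_right: "c *\<^sub>C (0::'a::complex_vector) = 0"
  using scaleC_add_right[of c "0::'a" 0] by simp

lemma scaleC_minus_right: "c *\<^sub>C (- x) = - (c *\<^sub>C (x::'a::complex_vector))"
  using scaleC_add_right[of c x "- x"] scaleC_zero_right[of c]
  by (metis add.right_inverse eq_neg_iff_add_eq_0 add.commute)

lemma norm_scaleC: "norm (c *\<^sub>C x) = cmod c * norm (x::'a::complex_inner)"
proof -
  have "complex_of_real ((norm (c *\<^sub>C x))\<^sup>2) = cinner (c *\<^sub>C x) (c *\<^sub>C x)"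
    by (simp only: cinner_self)
  also have "\<dots> = c * cinner x (c *\<^sub>C x)"
    by (simp only: cinner_scaleC_left)
  also have "\<dots> = c * cnj (c * cinner x x)"
    by (metis cinner_commute cinner_scaleC_left)
  also have "\<dots> = (c * cnj c) * complex_of_real ((norm x)\<^sup>2)"
    by (simp add: cinner_self)
  also have "\<dots> = complex_of_real ((cmod c * norm x)\<^sup>2)"
    by (simp add: complex_norm_square power_mult_distrib flip: of_real_power)
  finally have "(norm (c *\<^sub>C x))\<^sup>2 = (cmod c * norm x)\<^sup>2"
    using of_real_eq_iff by blast
  then show ?thesis
    by (simp add: power2_eq_iff_nonneg)
qed

text \<open>Multiplication is composition.  There is no \<open>ring_1\<close> instance because
  \<open>0 = 1\<close> on the trivial space.\<close>

instantiation bop :: (complex_inner) "{complex_vector, ring, monoid_mult}"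
begin

lift_definition zero_bop :: "'a bop" is "\<lambda>x. 0"
  by (auto simp: clinear_def scaleC_zero_right intro: exI[of _ 0])

lift_definition one_bop :: "'a bop" is "\<lambda>x. x"
  by (auto simp: clinear_def intro: exI[of _ 1])

lift_definition plus_bop :: "'a bop \<Rightarrow> 'a bop \<Rightarrow> 'a bop" is "\<lambda>f g x. f x + g x"
proof (intro conjI)
  fix f g :: "'a \<Rightarrow> 'a"
  assume f: "clinear f \<and> (\<exists>K. \<forall>x. norm (f x) \<le> K * norm x)"
    and g: "clinear g \<and> (\<exists>K. \<forall>x. norm (g x) \<le> K * norm x)"
  then show "clinear (\<lambda>x. f x + g x)"
    by (simp add: clinear_def scaleC_add_right algebra_simps)
  obtain K L where "\<forall>x. norm (f x) \<le> K * norm x" "\<forall>x. norm (g x) \<le> L * norm x"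
    using f g by blast
  then show "\<exists>K. \<forall>x. norm (f x + g x) \<le> K * norm x"
    by (intro exI[of _ "K + L"]) (metis distrib_right norm_triangle_mono)
qed

lift_definition uminus_bop :: "'a bop \<Rightarrow> 'a bop" is "\<lambda>f x. - f x"
  by (simp add: clinear_def scaleC_minus_right)

definition minus_bop :: "'a bop \<Rightarrow> 'a bop \<Rightarrow> 'a bop" where
  "minus_bop A B = A + - B"

lift_definition times_bop :: "'a bop \<Rightarrow> 'a bop \<Rightarrow> 'a bop" is "\<lambda>f g x. f (g x)"
proof (intro conjI)
  fix f g :: "'a \<Rightarrow> 'a"
  assume f: "clinear f \<and> (\<exists>K. \<forall>x. norm (f x) \<le> K * norm x)"
    and g: "clinear g \<and> (\<exists>K. \<forall>x. norm (g x) \<le> K * norm x)"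
  then show "clinear (\<lambda>x. f (g x))"
    by (simp add: clinear_def)
  obtain K L where K: "\<And>x. norm (f x) \<le> K * norm x" and L: "\<And>x. norm (g x) \<le> L * norm x"
    using f g by blast
  have "norm (f (g x)) \<le> (\<bar>K\<bar> * \<bar>L\<bar>) * norm x" for x
  proof -
    have "norm (f (g x)) \<le> \<bar>K\<bar> * norm (g x)"
      using K[of "g x"] by (meson abs_ge_self mult_right_mono norm_ge_zero order_trans)
    also have "norm (g x) \<le> \<bar>L\<bar> * norm x"
      using L[of x] by (meson abs_ge_self mult_right_mono norm_ge_zero order_trans)
    finally show ?thesis
      by (simp add: mult.assoc mult_left_mono)
  qed
  then show "\<exists>K. \<forall>x. norm (f (g x)) \<le> K * norm x" by blast
qed

lift_definition scaleC_bop :: "complex \<Rightarrow> 'a bop \<Rightarrow> 'a bop" is "\<lambda>c f x. c *\<^sub>C f x"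
proof (intro conjI)
  fix c :: complex and f :: "'a \<Rightarrow> 'a"
  assume f: "clinear f \<and> (\<exists>K. \<forall>x. norm (f x) \<le> K * norm x)"
  then show "clinear (\<lambda>x. c *\<^sub>C f x)"
    by (simp add: clinear_def scaleC_add_right scaleC_scaleC mult.commute)
  obtain K where "\<forall>x. norm (f x) \<le> K * norm x"
    using f by blast
  then show "\<exists>K. \<forall>x. norm (c *\<^sub>C f x) \<le> K * norm x"
    by (intro exI[of _ "cmod c * K"]) (simp add: norm_scaleC mult.assoc mult_left_mono)
qed

instance
proof
  fix A B C :: "'a bop" and a b :: complex
  show "A + B + C = A + (B + C)" by transfer (simp add: add.assoc)
  show "A + B = B + A" by transfer (simp add: add.commute)
  show "0 + A = A" by transfer simp
  show "- A + A = 0" by transfer simp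
  show "A - B = A + - B" by (simp add: minus_bop_def)
  show "A * B * C = A * (B * C)" by transfer simp
  show "(A + B) * C = A * C + B * C" by transfer simp
  show "A * (B + C) = A * B + A * C" by transfer (simp add: clinear_def)
  show "1 * A = A" by transfer simp
  show "A * 1 = A" by transfer simp
  show "a *\<^sub>C (A + B) = a *\<^sub>C A + a *\<^sub>C B" by transfer (simp add: scaleC_add_right)
  show "(a + b) *\<^sub>C A = a *\<^sub>C A + b *\<^sub>C A" by transfer (simp add: scaleC_add_left)
  show "a *\<^sub>C b *\<^sub>C A = (a * b) *\<^sub>C A" by transfer (simp add: scaleC_scaleC)
  show "1 *\<^sub>C A = A" by transfer (simp add: scaleC_one)
qed

end

definition self_adjoint :: "'a::complex_inner bop \<Rightarrow> bool" where
  "self_adjoint A \<longleftrightarrow> (\<forall>x y. cinner (A *\<^sub>V x) y = cinner x (A *\<^sub>V y))"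

definition positive_op :: "'a::complex_inner bop \<Rightarrow> bool" where
  "positive_op A \<longleftrightarrow> self_adjoint A \<and> (\<forall>x. 0 \<le> Re (cinner (A *\<^sub>V x) x))"

definition op_le :: "'a::complex_inner bop \<Rightarrow> 'a bop \<Rightarrow> bool"  (infix \<open>\<preceq>\<close> 50) where
  "A \<preceq> B \<longleftrightarrow> self_adjoint A \<and> self_adjoint B \<and> positive_op (B - A)"

definition positive_linear_map ::
    "('a::complex_inner bop \<Rightarrow> 'b::complex_inner bop) \<Rightarrow> bool" where
  "positive_linear_map \<Phi> \<longleftrightarrow> clinear \<Phi> \<and> (\<forall>A. positive_op A \<longrightarrow> positive_op (\<Phi> A))"

definition invertible_op :: "'a::complex_inner bop \<Rightarrow> bool" where
  "invertible_op A \<longleftrightarrow> (\<exists>B. A * B = 1 \<and> B * A = 1)"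

definition spectrum :: "'a::complex_inner bop \<Rightarrow> complex set" where
  "spectrum A = {z. \<not> invertible_op (A - z *\<^sub>C 1)}"

section \<open>Bounded Borel functional calculus of a self-adjoint operator\<close>

text \<open>The spectral measure of a self-adjoint \<open>A\<close> at the vector \<open>x\<close>: the finite Borel
  measure \<open>\<mu>\<close> concentrated on the spectrum for which
  \<open>\<langle>p(A)x, x\<rangle> = \<integral> p d\<mu>\<close> for every polynomial \<open>p\<close>.  As the spectrum is compact,
  the polynomials are dense in the continuous functions on it, so this is the measure that the
  Riesz representation theorem assigns to the functional \<open>h \<mapsto> \<langle>h(A)x, x\<rangle>\<close> of the
  continuous functional calculus.\<close>

definition spectral_measure_at :: "'a::complex_hilbert bop \<Rightarrow> 'a \<Rightarrow> real measure" where
  "spectral_measure_at A x = (THE \<mu>.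
     sets \<mu> = sets borel \<and> finite_measure \<mu> \<and>
     (AE s in \<mu>. complex_of_real s \<in> spectrum A) \<and>
     (\<forall>n. cinner (A ^ n *\<^sub>V x) x = complex_of_real (\<integral>s. s ^ n \<partial>\<mu>)))"

text \<open>For self-adjoint \<open>A\<close> and \<open>g\<close> bounded and Borel on the spectrum, \<open>g(A)\<close> is the
  operator with \<open>\<langle>g(A)x, x\<rangle> = \<integral> g d\<mu>\<^sub>x\<close> for all \<open>x\<close>, where \<open>\<mu>\<^sub>x\<close> is the spectral
  measure of \<open>A\<close> at \<open>x\<close>; by polarization it is determined by these values.  Only the
  values of \<open>g\<close> on the spectrum matter.\<close>

definition borel_calculus :: "(real \<Rightarrow> real) \<Rightarrow> 'a::complex_hilbert bop \<Rightarrow> 'a bop" where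
  "borel_calculus g A = (THE T. \<forall>x. cinner (T *\<^sub>V x) x =
     complex_of_real
       (\<integral>s\<in>{s. complex_of_real s \<in> spectrum A}. g s \<partial>spectral_measure_at A x))"

end

theory Submission
  imports Defs "HOL-Probability.Probability" "HOL-Computational_Algebra.Polynomial"
begin

text \<open>
  The inequality is a scalar tangent inequality read twice through a functional calculus. Fix
  \<open>s \<in> J\<close>. On the spectrum of each \<open>A\<^sub>i\<close> the function \<open>f\<close> lies above its tangent
  \<open>t \<mapsto> C\<^sub>s (t - s) + f s\<close>, so \<open>f(A\<^sub>i)\<close> lies above the same affine function of \<open>A\<^sub>i\<close>
  (\<open>calculus_affine_lower_bound\<close>). Affine inequalities pass through a unital family of positive
  maps (\<open>affine_bound_transfer\<close>), which gives for a unit vector \<open>x\<close>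

    \<open>C\<^sub>s \<langle>Sx, x\<rangle> + (f s - C\<^sub>s s) \<le> \<langle>(\<Sum>\<Phi>\<^sub>i(f(A\<^sub>i)))x, x\<rangle>\<close>.

  The right side does not depend on \<open>s\<close>. The spectrum of \<open>S\<close> is contained in \<open>J\<close>
  (\<open>real_spectrum_positive_combination\<close>), so this can be integrated in \<open>s\<close> against the spectral
  measure of \<open>S\<close> at \<open>x\<close>, a probability measure, with the result

    \<open>\<langle>f(S)x, x\<rangle> \<le> \<langle>(\<Sum>\<Phi>\<^sub>i(f(A\<^sub>i)))x, x\<rangle> + \<langle>C\<^sub>S Sx, x\<rangle> - \<langle>Sx, x\<rangle> \<langle>C\<^sub>S x, x\<rangle>\<close>

  (\<open>tangent_integral_bound\<close>). The last two terms are at most \<open>\<zeta>\<close>.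

  Most of the work is the spectral theorem that gives these integrals a meaning: the spectral
  measures exist and are unique, and bounded Borel functions of \<open>A\<close> are operators.

  The spectral measure at \<open>x\<close> is the solution of a moment problem. After an affine change of
  variable \<open>0 \<le> A \<le> 1\<close>, and then \<open>A\<^sup>i (1 - A)\<^sup>j \<ge> 0\<close> (\<open>bernstein_positive\<close>), so that the
  values of \<open>p \<mapsto> \<langle>p(A)x, x\<rangle>\<close> on Bernstein polynomials are the weights of discrete
  probability measures on \<open>[0, 1]\<close>. By Helly's selection theorem a subsequence converges weakly,
  and its limit has the required moments (\<open>hausdorff_moment_problem\<close>). A measure with compact
  support is determined by its moments (\<open>measure_eqI_moments\<close>), and this one does not charge the
  complement of the spectrum (\<open>AE_in_real_spectrum\<close>).

  For a bounded Borel function \<open>h\<close>, the map \<open>p \<mapsto> p(A)x\<close> is isometric from the polynomials in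
  \<open>L\<^sup>2(\<mu>\<^sub>x)\<close>, where they are dense (\<open>polynomials_dense\<close>). Hence \<open>h(A)x\<close> can be defined as the
  limit of \<open>p\<^sub>k(A)x\<close> for \<open>p\<^sub>k \<longlonglongrightarrow> h\<close>; density holds for several measures \<open>\<mu>\<^sub>x\<close> at the
  same time, which makes this linear in \<open>x\<close> (\<open>calculus_operator_exists\<close>).
\<close>

section \<open>Inner products and quadratic forms\<close>

lemma scaleC_of_real: "complex_of_real r *\<^sub>C x = r *\<^sub>R (x::'a::complex_inner)"
  by (simp add: scaleR_scaleC)

lemma cinner_zero_left [simp]: "cinner 0 y = 0"
  using cinner_add_left[of 0 0 y] by simp

lemma cinner_minus_left [simp]: "cinner (- x) y = - cinner x y"
  using cinner_add_left[of x "- x" y] by (simp add: add_eq_0_iff)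

lemma cinner_diff_left: "cinner (x - y) z = cinner x z - cinner y z"
  using cinner_add_left[of x "- y" z] by simp

lemma cinner_add_right: "cinner x (y + z) = cinner x y + cinner x z"
  by (metis cinner_add_left cinner_commute complex_cnj_add)

lemma cinner_zero_right [simp]: "cinner x 0 = 0"
  using cinner_add_right[of x 0 0] by simp

lemma cinner_minus_right [simp]: "cinner x (- y) = - cinner x y"
  using cinner_add_right[of x y "- y"] by (simp add: add_eq_0_iff)

lemma cinner_diff_right: "cinner x (y - z) = cinner x y - cinner x z"
  using cinner_add_right[of x y "- z"] by simp

lemma cinner_scaleC_right: "cinner x (c *\<^sub>C y) = cnj c * cinner x y"
  by (metis cinner_commute cinner_scaleC_left complex_cnj_mult)

lemma cinner_scaleR_left: "cinner (r *\<^sub>R x) y = complex_of_real r * cinner x y"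
  by (simp add: scaleR_scaleC cinner_scaleC_left)

lemma cinner_scaleR_right: "cinner x (r *\<^sub>R y) = complex_of_real r * cinner x y"
  by (simp add: scaleR_scaleC cinner_scaleC_right)

lemma Re_cinner_self: "Re (cinner x x) = (norm x)\<^sup>2"
  by (simp add: cinner_self del: of_real_power)

lemma Re_cinner_commute: "Re (cinner x y) = Re (cinner y x)"
  by (subst cinner_commute) simp

lemma norm_add_squared:
  "(norm (x + y))\<^sup>2 = (norm x)\<^sup>2 + 2 * Re (cinner x y) + (norm (y::'a::complex_inner))\<^sup>2"
  using Re_cinner_commute[of x y]
  by (simp add: Re_cinner_self[symmetric] cinner_add_left cinner_add_right)

lemma norm_diff_squared:
  "(norm (x - y))\<^sup>2 = (norm x)\<^sup>2 - 2 * Re (cinner x y) + (norm (y::'a::complex_inner))\<^sup>2"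
  using norm_add_squared[of x "- y"] by simp

text \<open>The norm axioms already contain the triangle inequality, and squaring it gives the
  Cauchy--Schwarz inequality.\<close>

lemma Re_cinner_le: "Re (cinner x y) \<le> norm x * norm (y::'a::complex_inner)"
proof -
  have "(norm (x + y))\<^sup>2 \<le> (norm x + norm y)\<^sup>2"
    by (intro power_mono norm_triangle_ineq) simp
  then show ?thesis
    by (simp add: norm_add_squared power2_sum)
qed

lemma abs_Re_cinner_le: "\<bar>Re (cinner x y)\<bar> \<le> norm x * norm (y::'a::complex_inner)"
  using Re_cinner_le[of x y] Re_cinner_le[of "- x" y] by simp

text \<open>Rotating \<open>x\<close> by the conjugate of \<open>\<langle>x, y\<rangle>\<close> makes the inner product real, which reduces
  the complex Cauchy--Schwarz inequality to the real one.\<close>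

lemma cmod_cinner_le: "cmod (cinner x y) \<le> norm x * norm (y::'a::complex_inner)"
proof (cases "cinner x y = 0")
  case False
  let ?c = "cinner x y"
  have "(cmod ?c)\<^sup>2 = Re (cinner (cnj ?c *\<^sub>C x) y)"
    by (simp add: cinner_scaleC_left cmod_power2) (simp add: power2_eq_square)
  also have "\<dots> \<le> cmod ?c * (norm x * norm y)"
    using Re_cinner_le[of "cnj ?c *\<^sub>C x" y] by (simp add: norm_scaleC mult.assoc)
  finally show ?thesis
    using False by (simp add: power2_eq_square)
qed simp

text \<open>Polarization: the diagonal at \<open>x + y\<close> shows that \<open>D\<close> is antisymmetric, the diagonal at
  \<open>x + \<i>y\<close> that it is symmetric. The second step needs complex scalars; a right-angle rotation
  of the real plane has zero quadratic form.\<close>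

lemma sesquilinear_eq_0I:
  fixes D :: "'a::complex_vector \<Rightarrow> 'a \<Rightarrow> complex"
  assumes add_left: "\<And>x y z. D (x + y) z = D x z + D y z"
    and add_right: "\<And>x y z. D x (y + z) = D x y + D x z"
    and scale_left: "\<And>c x y. D (c *\<^sub>C x) y = c * D x y"
    and scale_right: "\<And>c x y. D x (c *\<^sub>C y) = cnj c * D x y"
    and diag: "\<And>x. D x x = 0"
  shows "D x y = 0"
proof -
  have "D x y + D y x = 0"
    using diag[of "x + y"] unfolding add_left add_right by (simp add: diag add.commute)
  moreover have "- \<i> * D x y + \<i> * D y x = 0"
    using diag[of "x + \<i> *\<^sub>C y"]
    unfolding add_left add_right scale_left scale_right by (simp add: diag)
  then have "\<i> * (D y x - D x y) = 0"
    by (simp add: algebra_simps)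
  then have "D y x = D x y"
    by simp
  ultimately show ?thesis
    by simp
qed

section \<open>Bounded operators\<close>

lemma bop_zero [simp]: "0 *\<^sub>V x = 0"
  by transfer simp

lemma bop_one [simp]: "1 *\<^sub>V x = x"
  by transfer simp

lemma bop_plus: "(A + B) *\<^sub>V x = A *\<^sub>V x + B *\<^sub>V x"
  by transfer simp

lemma bop_uminus: "(- A) *\<^sub>V x = - (A *\<^sub>V x)"
  by transfer simp

lemma bop_minus: "(A - B) *\<^sub>V x = A *\<^sub>V x - B *\<^sub>V x"
  unfolding minus_bop_def bop_plus bop_uminus by simp

lemma bop_times: "(A * B) *\<^sub>V x = A *\<^sub>V B *\<^sub>V x"
  by transfer simp

lemma bop_scaleC: "(c *\<^sub>C A) *\<^sub>V x = c *\<^sub>C (A *\<^sub>V x)"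
  by transfer simp

lemmas bop_simps = bop_plus bop_uminus bop_minus bop_times bop_scaleC

lemma bop_add_right: "A *\<^sub>V (x + y) = A *\<^sub>V x + A *\<^sub>V y"
  by transfer (simp add: clinear_def)

lemma bop_scaleC_right: "A *\<^sub>V (c *\<^sub>C x) = c *\<^sub>C (A *\<^sub>V x)"
  by transfer (simp add: clinear_def)

lemma bop_zero_right [simp]: "A *\<^sub>V 0 = 0"
  using bop_add_right[of A 0 0] by simp

lemma bop_minus_right: "A *\<^sub>V (x - y) = A *\<^sub>V x - A *\<^sub>V y"
  using bop_add_right[of A "x - y" y] by (simp add: algebra_simps)

lemma bop_scaleR_right: "A *\<^sub>V (r *\<^sub>R x) = r *\<^sub>R (A *\<^sub>V x)"
  by (simp add: scaleR_scaleC bop_scaleC_right)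

lemma bop_bounded:
  fixes A :: "'a::complex_inner bop"
  obtains K where "K > 0" "\<And>x. norm (A *\<^sub>V x) \<le> K * norm x"
proof -
  have "\<exists>K. \<forall>x. norm (A *\<^sub>V x) \<le> K * norm x"
    by transfer blast
  then obtain K where K: "\<And>x. norm (A *\<^sub>V x) \<le> K * norm x"
    by blast
  have "norm (A *\<^sub>V x) \<le> max K 1 * norm x" for x
    using K[of x] by (meson max.cobounded1 mult_right_mono norm_ge_zero order_trans)
  then show thesis
    by (intro that[of "max K 1"]) auto
qed

lemma bop_of_linear:
  fixes F :: "'a::complex_inner \<Rightarrow> 'a"
  assumes "\<And>x y. F (x + y) = F x + F y" "\<And>c x. F (c *\<^sub>C x) = c *\<^sub>C F x"
    and "\<And>x. norm (F x) \<le> K * norm x"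
  obtains T where "\<And>x. T *\<^sub>V x = F x"
proof
  have "F \<in> {f. clinear f \<and> (\<exists>K. \<forall>x. norm (f x) \<le> K * norm x)}"
    using assms by (auto simp: clinear_def)
  then show "Bop F *\<^sub>V x = F x" for x
    by (simp add: Bop_inverse)
qed

text \<open>Consequences of polarization. The functional calculus prescribes an operator by its form
  \<open>\<langle>Tx, x\<rangle>\<close>, which is why uniqueness and self-adjointness are read off from this form.\<close>

lemma bop_eqI_quadratic:
  assumes "\<And>x. cinner (A *\<^sub>V x) x = cinner (B *\<^sub>V x) x"
  shows "A = B"
proof (rule bop_eqI)
  fix x
  have "cinner ((A - B) *\<^sub>V x) ((A - B) *\<^sub>V x) = 0"
    by (rule sesquilinear_eq_0I[of "\<lambda>x y. cinner ((A - B) *\<^sub>V x) y"])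
      (simp_all add: bop_add_right bop_scaleC_right cinner_add_left cinner_add_right
        cinner_scaleC_left cinner_scaleC_right bop_minus cinner_diff_left assms algebra_simps)
  then show "A *\<^sub>V x = B *\<^sub>V x"
    by (simp add: cinner_self bop_minus)
qed

lemma self_adjointI_real:
  assumes "\<And>x. Im (cinner (A *\<^sub>V x) x) = 0"
  shows "self_adjoint A"
  unfolding self_adjoint_def
proof (intro allI)
  fix x y
  have diag: "cinner (A *\<^sub>V x) x = cinner x (A *\<^sub>V x)" for x
    using assms[of x] by (subst cinner_commute) (rule complex_eqI; simp)
  have "cinner (A *\<^sub>V x) y - cinner x (A *\<^sub>V y) = 0"
    by (rule sesquilinear_eq_0I[of "\<lambda>x y. cinner (A *\<^sub>V x) y - cinner x (A *\<^sub>V y)"])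
      (simp_all add: bop_add_right bop_scaleC_right cinner_add_left cinner_add_right
        cinner_scaleC_left cinner_scaleC_right diag algebra_simps)
  then show "cinner (A *\<^sub>V x) y = cinner x (A *\<^sub>V y)"
    by simp
qed

lemma self_adjoint_Im:
  assumes "self_adjoint A"
  shows "Im (cinner (A *\<^sub>V x) x) = 0"
proof -
  have "cinner (A *\<^sub>V x) x = cnj (cinner (A *\<^sub>V x) x)"
    using assms by (metis cinner_commute self_adjoint_def)
  from arg_cong[OF this, of Im] show ?thesis
    by simp
qed

lemma self_adjoint_cinner: "self_adjoint A \<Longrightarrow> cinner (A *\<^sub>V x) y = cinner x (A *\<^sub>V y)"
  by (simp add: self_adjoint_def)

lemma self_adjoint_of_real: "self_adjoint (complex_of_real r *\<^sub>C 1)"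
  by (simp add: self_adjoint_def bop_simps cinner_scaleC_left cinner_scaleC_right)

lemma self_adjoint_scale_real: "self_adjoint A \<Longrightarrow> self_adjoint (complex_of_real r *\<^sub>C A)"
  by (simp add: self_adjoint_def bop_simps cinner_scaleC_left cinner_scaleC_right)

lemma self_adjoint_plus: "self_adjoint A \<Longrightarrow> self_adjoint B \<Longrightarrow> self_adjoint (A + B)"
  by (simp add: self_adjoint_def bop_simps cinner_add_left cinner_add_right)

lemma self_adjoint_minus: "self_adjoint A \<Longrightarrow> self_adjoint B \<Longrightarrow> self_adjoint (A - B)"
  by (simp add: self_adjoint_def bop_simps cinner_diff_left cinner_diff_right)

lemma self_adjoint_zero: "self_adjoint 0"
  by (simp add: self_adjoint_def)

lemma self_adjoint_sum: "(\<And>i. i \<in> I \<Longrightarrow> self_adjoint (A i)) \<Longrightarrow> self_adjoint (\<Sum>i\<in>I. A i)"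
  by (induction I rule: infinite_finite_induct) (auto simp: self_adjoint_plus self_adjoint_zero)

lemma self_adjoint_times:
  "self_adjoint A \<Longrightarrow> self_adjoint B \<Longrightarrow> A * B = B * A \<Longrightarrow> self_adjoint (A * B)"
  by (metis bop_times self_adjoint_def)

section \<open>Invertibility and the real spectrum\<close>

lemma invertible_op_bounded_below:
  fixes A :: "'a::complex_inner bop"
  assumes "invertible_op A"
  obtains \<delta> where "\<delta> > 0" "\<And>x. \<delta> * norm x \<le> norm (A *\<^sub>V x)"
proof -
  obtain B where B: "B * A = 1"
    using assms by (auto simp: invertible_op_def)
  obtain K where K: "K > 0" "\<And>x. norm (B *\<^sub>V x) \<le> K * norm x"
    using bop_bounded by blast
  have "norm x \<le> K * norm (A *\<^sub>V x)" for x
    using K(2)[of "A *\<^sub>V x"] B by (metis bop_one bop_times)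
  then have "(1 / K) * norm x \<le> norm (A *\<^sub>V x)" for x
    using K(1) by (simp add: field_simps)
  with K(1) show thesis
    by (intro that[of "1 / K"]) auto
qed

lemma invertible_op_of_bijection:
  fixes A :: "'a::complex_inner bop"
  assumes "\<delta> > 0" and below: "\<And>x. \<delta> * norm x \<le> norm (A *\<^sub>V x)"
    and surj: "\<And>y. \<exists>x. A *\<^sub>V x = y"
  shows "invertible_op A"
proof -
  define F where "F y = (SOME x. A *\<^sub>V x = y)" for y
  have AF: "A *\<^sub>V F y = y" for y
    unfolding F_def using surj by (rule someI_ex)
  have inj: "x = y" if "A *\<^sub>V x = A *\<^sub>V y" for x y
    using below[of "x - y"] that \<open>\<delta> > 0\<close> by (simp add: bop_minus_right mult_le_0_iff)
  have FA: "F (A *\<^sub>V x) = x" for x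
    by (rule inj) (rule AF)
  have "F (x + y) = F x + F y" for x y
    by (rule inj) (simp add: AF bop_add_right)
  moreover have "F (c *\<^sub>C x) = c *\<^sub>C F x" for c x
    by (rule inj) (simp add: AF bop_scaleC_right)
  moreover have "norm (F x) \<le> (1 / \<delta>) * norm x" for x
    using below[of "F x"] \<open>\<delta> > 0\<close> by (simp add: AF field_simps)
  ultimately obtain T where T: "\<And>x. T *\<^sub>V x = F x"
    using bop_of_linear by blast
  have "A * T = 1" "T * A = 1"
    by (rule bop_eqI; simp add: bop_times T AF FA)+
  then show ?thesis
    by (auto simp: invertible_op_def)
qed

text \<open>The Lax--Milgram argument: with \<open>|Ax| \<le> K|x|\<close>, the map
  \<open>x \<mapsto> x - (\<delta>/K\<^sup>2)(Ax - y)\<close> contracts squared distances by \<open>1 - \<delta>\<^sup>2/K\<^sup>2\<close>, and its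
  fixed point solves \<open>Ax = y\<close>.\<close>

lemma coercive_imp_invertible:
  fixes A :: "'a::complex_hilbert bop"
  assumes "\<delta> > 0" and coercive: "\<And>x. \<delta> * (norm x)\<^sup>2 \<le> Re (cinner (A *\<^sub>V x) x)"
  shows "invertible_op A"
proof (rule invertible_op_of_bijection)
  show "\<delta> > 0" by fact
  show "\<delta> * norm x \<le> norm (A *\<^sub>V x)" for x
  proof (cases "norm x = 0")
    case False
    have "\<delta> * norm x * norm x \<le> norm (A *\<^sub>V x) * norm x"
      using coercive[of x] Re_cinner_le[of "A *\<^sub>V x" x] by (simp add: power2_eq_square)
    then show ?thesis
      using False by (simp add: mult_le_cancel_right)
  qed simp
  fix y
  obtain K0 where K0: "K0 > 0" "\<And>x. norm (A *\<^sub>V x) \<le> K0 * norm x"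
    using bop_bounded by blast
  define K where "K = K0 + \<delta>"
  have K: "K > 0" "\<delta> \<le> K" "norm (A *\<^sub>V x) \<le> K * norm x" for x
    using K0(1) K0(2)[of x] \<open>\<delta> > 0\<close> norm_ge_zero[of x] by (auto simp: K_def distrib_right intro: add_increasing2)
  define r where "r = \<delta> / K\<^sup>2"
  define q where "q = 1 - \<delta>\<^sup>2 / K\<^sup>2"
  have q: "0 \<le> q" "q < 1"
    using K(1,2) \<open>\<delta> > 0\<close> by (auto simp: q_def power_mono)
  have r: "r > 0" using K \<open>\<delta> > 0\<close> by (simp add: r_def)
  have contr: "norm (x - r *\<^sub>R (A *\<^sub>V x)) \<le> sqrt q * norm x" for x
  proof -
    have "(norm (x - r *\<^sub>R (A *\<^sub>V x)))\<^sup>2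
        = (norm x)\<^sup>2 - 2 * r * Re (cinner (A *\<^sub>V x) x) + r\<^sup>2 * (norm (A *\<^sub>V x))\<^sup>2"
      using Re_cinner_commute[of x "A *\<^sub>V x"]
      by (simp add: norm_diff_squared cinner_scaleR_right power_mult_distrib)
    also have "\<dots> \<le> (norm x)\<^sup>2 - 2 * r * (\<delta> * (norm x)\<^sup>2) + r\<^sup>2 * (K * norm x)\<^sup>2"
      using K(3)[of x] coercive[of x] r
      by (intro add_mono diff_mono mult_left_mono power_mono) auto
    also have "\<dots> = q * (norm x)\<^sup>2"
      using K(1) by (simp add: r_def q_def power2_eq_square field_simps)
    finally have "(norm (x - r *\<^sub>R (A *\<^sub>V x)))\<^sup>2 \<le> (sqrt q * norm x)\<^sup>2"
      using q by (simp add: power_mult_distrib)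
    then show ?thesis
      using q by (intro power2_le_imp_le[of "norm (x - r *\<^sub>R (A *\<^sub>V x))"]) auto
  qed
  define G where "G x = x - r *\<^sub>R (A *\<^sub>V x - y)" for x
  have "dist (G x) (G z) \<le> sqrt q * dist x z" for x z
  proof -
    have "G x - G z = (x - z) - r *\<^sub>R (A *\<^sub>V (x - z))"
      by (simp add: G_def bop_minus_right algebra_simps)
    then show ?thesis
      using contr[of "x - z"] by (simp add: dist_norm)
  qed
  then obtain x where "G x = x"
    using banach_fix_type[of "sqrt q" G] q by auto
  then show "\<exists>x. A *\<^sub>V x = y"
    using r by (auto simp: G_def)
qed

lemma self_adjoint_invertible_iff:
  fixes A :: "'a::complex_hilbert bop"
  assumes A: "self_adjoint A"
  shows "invertible_op A \<longleftrightarrow> (\<exists>\<delta>>0. \<forall>x. \<delta> * norm x \<le> norm (A *\<^sub>V x))"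
proof
  assume "\<exists>\<delta>>0. \<forall>x. \<delta> * norm x \<le> norm (A *\<^sub>V x)"
  then obtain \<delta> where \<delta>: "\<delta> > 0" "\<And>x. \<delta> * norm x \<le> norm (A *\<^sub>V x)"
    by blast
  \<comment> \<open>The square of \<open>A\<close> is coercive, since \<open>\<langle>AAx, x\<rangle> = |Ax|\<^sup>2\<close>.\<close>
  have "\<delta>\<^sup>2 * (norm x)\<^sup>2 \<le> Re (cinner ((A * A) *\<^sub>V x) x)" for x
  proof -
    have "(\<delta> * norm x)\<^sup>2 \<le> (norm (A *\<^sub>V x))\<^sup>2"
      using \<delta> by (intro power_mono) auto
    then show ?thesis
      by (simp add: bop_times self_adjoint_cinner[OF A, of "A *\<^sub>V x"] Re_cinner_self
          power_mult_distrib)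
  qed
  then have "invertible_op (A * A)"
    using \<delta>(1) by (intro coercive_imp_invertible[of "\<delta>\<^sup>2"]) auto
  then obtain B where B: "A * A * B = 1" "B * (A * A) = 1"
    by (auto simp: invertible_op_def)
  have "B * A = B * A * (A * A * B)"
    using B by simp
  also have "\<dots> = B * (A * A) * (A * B)"
    by (simp only: mult.assoc)
  also have "\<dots> = A * B"
    using B by simp
  finally have "B * A = A * B" .
  then show "invertible_op A"
    using B by (auto simp: invertible_op_def mult.assoc intro!: exI[of _ "A * B"])
qed (use invertible_op_bounded_below[of A] in blast)

text \<open>Spectral measures live on the real line, so the spectrum is wanted as a set of reals.\<close>

definition real_spectrum :: "'a::complex_inner bop \<Rightarrow> real set" where
  "real_spectrum A = {s. complex_of_real s \<in> spectrum A}"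

lemma not_in_real_spectrum_iff:
  fixes A :: "'a::complex_hilbert bop"
  assumes "self_adjoint A"
  shows "s \<notin> real_spectrum A \<longleftrightarrow> (\<exists>\<delta>>0. \<forall>x. \<delta> * norm x \<le> norm (A *\<^sub>V x - s *\<^sub>R x))"
  using self_adjoint_invertible_iff[of "A - complex_of_real s *\<^sub>C 1"] assms
  by (simp add: real_spectrum_def spectrum_def self_adjoint_minus self_adjoint_of_real
      bop_simps scaleC_of_real)

text \<open>A lower bound \<open>\<delta>\<close> for \<open>A - s\<close> drops by at most \<open>|t - s|\<close> when \<open>s\<close> is moved to \<open>t\<close>, and a
  self-adjoint operator that is bounded below is invertible.\<close>

lemma real_spectrum_gap:
  fixes A :: "'a::complex_hilbert bop"
  assumes A: "self_adjoint A" and s: "s \<notin> real_spectrum A"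
  obtains \<delta> where "\<delta> > 0" "\<And>x. \<delta> * norm x \<le> norm (A *\<^sub>V x - s *\<^sub>R x)"
    "\<And>t. t \<in> real_spectrum A \<Longrightarrow> \<delta> \<le> \<bar>t - s\<bar>"
proof -
  obtain \<delta> where \<delta>: "\<delta> > 0" "\<And>x. \<delta> * norm x \<le> norm (A *\<^sub>V x - s *\<^sub>R x)"
    using s not_in_real_spectrum_iff[OF A] by blast
  have "\<delta> \<le> \<bar>t - s\<bar>" if t: "t \<in> real_spectrum A" for t
  proof (rule ccontr)
    assume *: "\<not> \<delta> \<le> \<bar>t - s\<bar>"
    have "(\<delta> - \<bar>t - s\<bar>) * norm x \<le> norm (A *\<^sub>V x - t *\<^sub>R x)" for x
    proof -
      have "norm (A *\<^sub>V x - s *\<^sub>R x) \<le> norm (A *\<^sub>V x - t *\<^sub>R x) + norm ((t - s) *\<^sub>R x)"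
        using norm_triangle_ineq[of "A *\<^sub>V x - t *\<^sub>R x" "(t - s) *\<^sub>R x"]
        by (simp add: algebra_simps)
      with \<delta>(2)[of x] show ?thesis
        unfolding norm_scaleR left_diff_distrib by linarith
    qed
    then show False
      using * t not_in_real_spectrum_iff[OF A, of t] by (metis diff_gt_0_iff_gt not_less)
  qed
  with \<delta> show thesis
    by (intro that)
qed

lemma closed_real_spectrum:
  fixes A :: "'a::complex_hilbert bop"
  assumes A: "self_adjoint A"
  shows "closed (real_spectrum A)"
  unfolding closed_def open_dist
proof (intro ballI)
  fix s assume "s \<in> - real_spectrum A"
  then obtain \<delta> where "\<delta> > 0" "\<And>t. t \<in> real_spectrum A \<Longrightarrow> \<delta> \<le> \<bar>t - s\<bar>"
    using real_spectrum_gap[OF A, of s] by (metis ComplD)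
  then show "\<exists>e>0. \<forall>t. dist t s < e \<longrightarrow> t \<in> - real_spectrum A"
    by (intro exI[of _ \<delta>]) (force simp: dist_real_def)
qed

lemma real_spectrum_bounded:
  fixes A :: "'a::complex_hilbert bop"
  assumes A: "self_adjoint A" and K: "\<And>x. norm (A *\<^sub>V x) \<le> K * norm x"
    and s: "s \<in> real_spectrum A"
  shows "\<bar>s\<bar> \<le> K"
proof (rule ccontr)
  assume *: "\<not> \<bar>s\<bar> \<le> K"
  have "(\<bar>s\<bar> - K) * norm x \<le> norm (A *\<^sub>V x - s *\<^sub>R x)" for x
    using norm_triangle_ineq2[of "s *\<^sub>R x" "A *\<^sub>V x"] K[of x]
    by (simp add: norm_minus_commute algebra_simps)
  then show False
    using * s not_in_real_spectrum_iff[OF A, of s] by (metis diff_gt_0_iff_gt not_less)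
qed

lemma compact_real_spectrum:
  fixes A :: "'a::complex_hilbert bop"
  assumes A: "self_adjoint A"
  shows "compact (real_spectrum A)"
proof -
  obtain K where "\<And>x. norm (A *\<^sub>V x) \<le> K * norm x"
    using bop_bounded by blast
  then have "bounded (real_spectrum A)"
    using real_spectrum_bounded[OF A] by (auto simp: bounded_iff)
  then show ?thesis
    by (simp add: compact_eq_bounded_closed closed_real_spectrum[OF A])
qed

section \<open>Real polynomials of an operator\<close>

definition poly_op :: "'a::complex_inner bop \<Rightarrow> real poly \<Rightarrow> 'a bop" where
  "poly_op A p = fold_coeffs (\<lambda>a B. complex_of_real a *\<^sub>C 1 + A * B) p 0"

lemma scaleC_zero_left [simp]: "(0::complex) *\<^sub>C x = (0::'a::complex_vector)"
  using scaleC_add_left[of 0 0 x] by simp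

lemma poly_op_0 [simp]: "poly_op A 0 = 0"
  by (simp add: poly_op_def)

lemma poly_op_pCons [simp]: "poly_op A (pCons a p) = complex_of_real a *\<^sub>C 1 + A * poly_op A p"
  by (cases "p = 0 \<and> a = 0") (auto simp: poly_op_def)

lemma bop_times_scaleC: "(A :: 'a::complex_inner bop) * (c *\<^sub>C B) = c *\<^sub>C (A * B)"
  by (rule bop_eqI) (simp add: bop_simps bop_scaleC_right)

lemma bop_scaleC_times: "(c *\<^sub>C (A :: 'a::complex_inner bop)) * B = c *\<^sub>C (A * B)"
  by (rule bop_eqI) (simp add: bop_simps)

lemma poly_op_add: "poly_op A (p + q) = poly_op A p + poly_op A q"
  by (induction p q rule: poly_induct2) (simp_all add: scaleC_add_left distrib_left)

lemma poly_op_smult: "poly_op A (smult c p) = complex_of_real c *\<^sub>C poly_op A p"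
  by (induction p) (simp_all add: scaleC_add_right scaleC_scaleC bop_times_scaleC scaleC_zero_right)

lemma poly_op_minus: "poly_op A (p - q) = poly_op A p - poly_op A q"
proof -
  have "poly_op A (p - q) + poly_op A q = poly_op A p"
    by (simp add: poly_op_add[symmetric])
  then show ?thesis
    by (simp add: algebra_simps)
qed

lemma poly_op_mult: "poly_op A (p * q) = poly_op A p * poly_op A q"
  by (induction p) (simp_all add: poly_op_add poly_op_smult distrib_right bop_scaleC_times mult.assoc)

lemma poly_op_1 [simp]: "poly_op A 1 = 1"
  by (simp add: one_pCons scaleC_one)

lemma poly_op_power: "poly_op A (p ^ n) = poly_op A p ^ n"
  by (induction n) (simp_all add: poly_op_mult)

lemma poly_op_X [simp]: "poly_op A [:0, 1:] = A"
  by (simp add: scaleC_one)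

lemma poly_op_pcompose: "poly_op A (pcompose p q) = poly_op (poly_op A q) p"
  by (induction p) (simp_all add: pcompose_pCons poly_op_add poly_op_mult)

lemma self_adjoint_poly_op:
  assumes "self_adjoint A"
  shows "self_adjoint (poly_op A p)"
proof (induction p)
  case (pCons a p)
  have "A * poly_op A p = poly_op A ([:0, 1:] * p)"
    by (simp only: poly_op_mult poly_op_X)
  also have "\<dots> = poly_op A (p * [:0, 1:])"
    by (simp only: mult.commute)
  also have "\<dots> = poly_op A p * A"
    by (simp only: poly_op_mult poly_op_X)
  finally show ?case
    using pCons by (simp add: self_adjoint_plus self_adjoint_of_real self_adjoint_times assms)
qed (simp add: self_adjoint_zero)

lemma cinner_poly_op_mult:
  assumes "self_adjoint A"
  shows "cinner (poly_op A (p * q) *\<^sub>V x) y = cinner (poly_op A q *\<^sub>V x) (poly_op A p *\<^sub>V y)"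
  by (simp add: poly_op_mult bop_times self_adjoint_cinner[OF self_adjoint_poly_op[OF assms]])

section \<open>Polynomials in \<open>L\<^sup>2\<close> of a compactly supported measure\<close>

definition borel_measure_on :: "real \<Rightarrow> real measure \<Rightarrow> bool" where
  "borel_measure_on K M \<longleftrightarrow> finite_measure M \<and> sets M = sets borel \<and> (AE s in M. \<bar>s\<bar> \<le> K)"

text \<open>A class of functions that contains the polynomials and the bounded Borel functions, is
  closed under the ring operations, and consists of functions integrable against every finite
  measure with compact support. Integrability of a compound integrand thus follows from its
  syntactic form, by the rules collected in \<open>lbb\<close>.\<close>

definition locally_bounded_borel :: "(real \<Rightarrow> real) \<Rightarrow> bool" where
  "locally_bounded_borel g \<longleftrightarrow>
     g \<in> borel_measurable borel \<and> (\<forall>K. \<exists>B. \<forall>s. \<bar>s\<bar> \<le> K \<longrightarrow> \<bar>g s\<bar> \<le> B)"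

named_theorems lbb

lemma lbb_measurable [measurable_dest]: "locally_bounded_borel g \<Longrightarrow> g \<in> borel_measurable borel"
  by (simp add: locally_bounded_borel_def)

lemma lbb_bounded:
  "g \<in> borel_measurable borel \<Longrightarrow> (\<And>s. \<bar>g s\<bar> \<le> B) \<Longrightarrow> locally_bounded_borel g"
  by (auto simp: locally_bounded_borel_def)

lemma lbb_continuous:
  assumes "continuous_on UNIV g"
  shows "locally_bounded_borel g"
  unfolding locally_bounded_borel_def
proof (intro conjI allI)
  show "g \<in> borel_measurable borel"
    using assms by (rule borel_measurable_continuous_onI)
  fix K
  have "compact (g ` {-K..K})"
    by (intro compact_continuous_image continuous_on_subset[OF assms]) auto
  then obtain B where "\<forall>y\<in>g ` {-K..K}. norm y \<le> B"
    using compact_imp_bounded bounded_iff by blast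
  then show "\<exists>B. \<forall>s. \<bar>s\<bar> \<le> K \<longrightarrow> \<bar>g s\<bar> \<le> B"
    by (intro exI[of _ B]) (auto simp: abs_le_iff)
qed

lemma lbb_const [lbb]: "locally_bounded_borel (\<lambda>s. c)"
  by (intro lbb_continuous continuous_intros)

lemma lbb_id [lbb]: "locally_bounded_borel (\<lambda>s. s)"
  by (intro lbb_continuous continuous_intros)

lemma lbb_poly [lbb]: "locally_bounded_borel (poly p)"
  by (intro lbb_continuous continuous_intros)

lemma lbb_indicator [lbb]: "A \<in> sets borel \<Longrightarrow> locally_bounded_borel (indicator A)"
  by (rule lbb_bounded[where B = 1]) (auto simp: indicator_def)

lemma lbb_add [lbb]:
  assumes "locally_bounded_borel g" "locally_bounded_borel h"
  shows "locally_bounded_borel (\<lambda>s. g s + h s)"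
  unfolding locally_bounded_borel_def
proof (intro conjI allI)
  show "(\<lambda>s. g s + h s) \<in> borel_measurable borel"
    using assms by (auto dest: lbb_measurable)
  fix K
  obtain B C where "\<And>s. \<bar>s\<bar> \<le> K \<Longrightarrow> \<bar>g s\<bar> \<le> B" "\<And>s. \<bar>s\<bar> \<le> K \<Longrightarrow> \<bar>h s\<bar> \<le> C"
    using assms unfolding locally_bounded_borel_def by meson
  then have "\<bar>g s + h s\<bar> \<le> B + C" if "\<bar>s\<bar> \<le> K" for s
    using that by (meson abs_triangle_ineq add_mono order_trans)
  then show "\<exists>B. \<forall>s. \<bar>s\<bar> \<le> K \<longrightarrow> \<bar>g s + h s\<bar> \<le> B"
    by blast
qed

lemma lbb_mult [lbb]:
  assumes "locally_bounded_borel g" "locally_bounded_borel h"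
  shows "locally_bounded_borel (\<lambda>s. g s * h s)"
  unfolding locally_bounded_borel_def
proof (intro conjI allI)
  show "(\<lambda>s. g s * h s) \<in> borel_measurable borel"
    using assms by (auto dest: lbb_measurable)
  fix K
  obtain B C where BC: "\<And>s. \<bar>s\<bar> \<le> K \<Longrightarrow> \<bar>g s\<bar> \<le> B" "\<And>s. \<bar>s\<bar> \<le> K \<Longrightarrow> \<bar>h s\<bar> \<le> C"
    using assms unfolding locally_bounded_borel_def by meson
  have "\<bar>g s * h s\<bar> \<le> B * C" if "\<bar>s\<bar> \<le> K" for s
    unfolding abs_mult using BC[OF that] by (intro mult_mono) auto
  then show "\<exists>B. \<forall>s. \<bar>s\<bar> \<le> K \<longrightarrow> \<bar>g s * h s\<bar> \<le> B"
    by blast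
qed

lemma lbb_diff [lbb]:
  assumes "locally_bounded_borel g" "locally_bounded_borel h"
  shows "locally_bounded_borel (\<lambda>s. g s - h s)"
  using lbb_add[OF assms(1) lbb_mult[OF lbb_const[of "-1"] assms(2)]] by simp

lemma lbb_power [lbb]: "locally_bounded_borel g \<Longrightarrow> locally_bounded_borel (\<lambda>s. g s ^ n)"
  by (induction n) (auto intro: lbb)

lemma lbb_abs [lbb]: "locally_bounded_borel g \<Longrightarrow> locally_bounded_borel (\<lambda>s. \<bar>g s\<bar>)"
  by (auto simp: locally_bounded_borel_def)

lemma borel_measurable_on [simp]:
  assumes "borel_measure_on K M" "g \<in> borel_measurable borel"
  shows "g \<in> borel_measurable M"
proof -
  have "sets M = sets borel"
    using assms(1) by (simp add: borel_measure_on_def)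
  then show ?thesis
    using assms(2) measurable_cong_sets by blast
qed

lemma integrable_lbb:
  assumes M: "borel_measure_on K M" and g: "locally_bounded_borel g"
  shows "integrable M g"
proof -
  obtain B where B: "\<And>s. \<bar>s\<bar> \<le> K \<Longrightarrow> \<bar>g s\<bar> \<le> B"
    using g by (auto simp: locally_bounded_borel_def)
  have "AE s in M. norm (g s) \<le> B"
    using M B by (auto simp: borel_measure_on_def)
  then show ?thesis
    using M g by (auto intro!: finite_measure.integrable_const_bound[where B = B] lbb_measurable
        borel_measurable_on[OF M] simp: borel_measure_on_def)
qed

lemma integral_mono_lbb:
  assumes "borel_measure_on K M" "locally_bounded_borel g" "locally_bounded_borel h"
    and "AE s in M. g s \<le> h s"
  shows "(\<integral>s. g s \<partial>M) \<le> (\<integral>s. h s \<partial>M)"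
  using assms by (intro integral_mono_AE integrable_lbb)

text \<open>Approximation in \<open>L\<^sup>2(M)\<close> by one and the same polynomial for all \<open>M \<in> N\<close>. The measures
  will be the spectral measures at finitely many vectors that satisfy a linear relation.\<close>

definition approximable :: "real measure set \<Rightarrow> (real \<Rightarrow> real) \<Rightarrow> bool" where
  "approximable N h \<longleftrightarrow> (\<forall>\<epsilon>>0. \<exists>p. \<forall>M\<in>N. (\<integral>s. (h s - poly p s)\<^sup>2 \<partial>M) < \<epsilon>)"

lemma power2_add_le: "(a + b)\<^sup>2 \<le> 2 * a\<^sup>2 + 2 * (b::real)\<^sup>2"
  using zero_le_power2[of "a - b"] by (simp add: power2_sum power2_diff)

context
  fixes N :: "real measure set" and K :: real
  assumes finite_N: "finite N" and N: "\<And>M. M \<in> N \<Longrightarrow> borel_measure_on K M"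
begin

lemma integral_square_triangle:
  assumes M: "M \<in> N" and lb: "locally_bounded_borel g" "locally_bounded_borel h"
  shows "(\<integral>s. (g s + h s)\<^sup>2 \<partial>M) \<le> 2 * (\<integral>s. (g s)\<^sup>2 \<partial>M) + 2 * (\<integral>s. (h s)\<^sup>2 \<partial>M)"
proof -
  have "(\<integral>s. (g s + h s)\<^sup>2 \<partial>M) \<le> (\<integral>s. 2 * (g s)\<^sup>2 + 2 * (h s)\<^sup>2 \<partial>M)"
    by (intro integral_mono_lbb[OF N[OF M]] lbb lb AE_I2 power2_add_le)
  also have "\<dots> = 2 * (\<integral>s. (g s)\<^sup>2 \<partial>M) + 2 * (\<integral>s. (h s)\<^sup>2 \<partial>M)"
    by (subst Bochner_Integration.integral_add)
      (auto intro!: integrable_lbb[OF N[OF M]] lbb lb)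
  finally show ?thesis .
qed

lemma approximable_limit:
  assumes h: "locally_bounded_borel h"
    and lim: "\<And>\<epsilon>. \<epsilon> > 0 \<Longrightarrow>
      \<exists>g. locally_bounded_borel g \<and> approximable N g \<and> (\<forall>M\<in>N. (\<integral>s. (h s - g s)\<^sup>2 \<partial>M) < \<epsilon>)"
  shows "approximable N h"
  unfolding approximable_def
proof (intro allI impI)
  fix \<epsilon> :: real assume "\<epsilon> > 0"
  then have e: "\<epsilon> / 4 > 0" by simp
  from lim[OF e] obtain g where g: "locally_bounded_borel g" "approximable N g"
    "\<forall>M\<in>N. (\<integral>s. (h s - g s)\<^sup>2 \<partial>M) < \<epsilon> / 4" by blast
  from g(2) e obtain p where p: "\<forall>M\<in>N. (\<integral>s. (g s - poly p s)\<^sup>2 \<partial>M) < \<epsilon> / 4"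
    unfolding approximable_def by blast
  have "(\<integral>s. (h s - poly p s)\<^sup>2 \<partial>M) < \<epsilon>" if "M \<in> N" for M
  proof -
    have "(\<integral>s. ((h s - g s) + (g s - poly p s))\<^sup>2 \<partial>M)
      \<le> 2 * (\<integral>s. (h s - g s)\<^sup>2 \<partial>M) + 2 * (\<integral>s. (g s - poly p s)\<^sup>2 \<partial>M)"
      using that by (intro integral_square_triangle lbb h g)
    moreover have "(\<integral>s. (h s - g s)\<^sup>2 \<partial>M) < \<epsilon> / 4" "(\<integral>s. (g s - poly p s)\<^sup>2 \<partial>M) < \<epsilon> / 4"
      using g(3) p that by auto
    ultimately show ?thesis
      by simp
  qed
  then show "\<exists>p. \<forall>M\<in>N. (\<integral>s. (h s - poly p s)\<^sup>2 \<partial>M) < \<epsilon>" by blast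
qed

lemma approximable_seq:
  assumes U: "\<And>i. U i \<in> borel_measurable borel" "\<And>i s. \<bar>U i s\<bar> \<le> B"
    and approx: "\<And>i. approximable N (U i)" and lim: "\<And>s. (\<lambda>i. U i s) \<longlonglongrightarrow> h s"
  shows "approximable N h"
proof (rule approximable_limit)
  have h: "h \<in> borel_measurable borel"
    by (rule borel_measurable_LIMSEQ_real[OF lim U(1)])
  have hB: "\<bar>h s\<bar> \<le> B" for s
    using lim[of s] U(2) by (intro LIMSEQ_le_const2[OF tendsto_rabs]) auto
  then show lb: "locally_bounded_borel h"
    using h by (intro lbb_bounded)
  have lbU: "locally_bounded_borel (U i)" for i
    using U by (intro lbb_bounded)
  fix \<epsilon> :: real assume "\<epsilon> > 0"
  have ev: "\<forall>\<^sub>F i in sequentially. (\<integral>s. (h s - U i s)\<^sup>2 \<partial>M) < \<epsilon>" if M: "M \<in> N" for M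
  proof -
    have "(\<lambda>i. \<integral>s. (h s - U i s)\<^sup>2 \<partial>M) \<longlonglongrightarrow> (\<integral>s. 0 \<partial>M)"
    proof (rule integral_dominated_convergence[where w = "\<lambda>s. (2 * B)\<^sup>2"])
      show "integrable M (\<lambda>s. (2 * B)\<^sup>2)"
        by (intro integrable_lbb[OF N[OF M]] lbb)
      show "(\<lambda>s. (h s - U i s)\<^sup>2) \<in> borel_measurable M" for i
        by (intro borel_measurable_on[OF N[OF M]] lbb_measurable lbb lb lbU)
      show "AE s in M. (\<lambda>i. (h s - U i s)\<^sup>2) \<longlonglongrightarrow> 0"
      proof (rule AE_I2)
        fix s show "(\<lambda>i. (h s - U i s)\<^sup>2) \<longlonglongrightarrow> 0"
          using tendsto_power[OF tendsto_diff[OF tendsto_const lim[of s]], of "h s" 2] by simp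
      qed
      show "AE s in M. norm ((h s - U i s)\<^sup>2) \<le> (2 * B)\<^sup>2" for i
      proof (rule AE_I2)
        fix s
        have "\<bar>h s - U i s\<bar> \<le> 2 * B"
          using hB[of s] U(2)[of i s] by linarith
        then show "norm ((h s - U i s)\<^sup>2) \<le> (2 * B)\<^sup>2"
          using power_mono[of "\<bar>h s - U i s\<bar>" "2 * B" 2] by simp
      qed
    qed simp
    then show ?thesis
      using \<open>\<epsilon> > 0\<close> by (intro order_tendstoD(2)[where y = 0]) auto
  qed
  have "\<forall>\<^sub>F i in sequentially. \<forall>M\<in>N. (\<integral>s. (h s - U i s)\<^sup>2 \<partial>M) < \<epsilon>"
    by (intro eventually_ball_finite[OF finite_N] ballI ev)
  then obtain i where "\<forall>M\<in>N. (\<integral>s. (h s - U i s)\<^sup>2 \<partial>M) < \<epsilon>"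
    using eventually_happens'[OF sequentially_bot] by blast
  then show "\<exists>g. locally_bounded_borel g \<and> approximable N g \<and> (\<forall>M\<in>N. (\<integral>s. (h s - g s)\<^sup>2 \<partial>M) < \<epsilon>)"
    using approx lbU by blast
qed

lemma approximable_add:
  assumes lb: "locally_bounded_borel g" "locally_bounded_borel h"
    and a: "approximable N g" "approximable N h"
  shows "approximable N (\<lambda>s. g s + h s)"
  unfolding approximable_def
proof (intro allI impI)
  fix \<epsilon> :: real assume "\<epsilon> > 0"
  then have e: "\<epsilon> / 4 > 0" by simp
  from a e obtain p q where pq: "\<forall>M\<in>N. (\<integral>s. (g s - poly p s)\<^sup>2 \<partial>M) < \<epsilon> / 4"
      "\<forall>M\<in>N. (\<integral>s. (h s - poly q s)\<^sup>2 \<partial>M) < \<epsilon> / 4"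
    unfolding approximable_def by blast
  have "(\<integral>s. (g s + h s - poly (p + q) s)\<^sup>2 \<partial>M) < \<epsilon>" if "M \<in> N" for M
  proof -
    have "(\<integral>s. ((g s - poly p s) + (h s - poly q s))\<^sup>2 \<partial>M)
      \<le> 2 * (\<integral>s. (g s - poly p s)\<^sup>2 \<partial>M) + 2 * (\<integral>s. (h s - poly q s)\<^sup>2 \<partial>M)"
      using that by (intro integral_square_triangle lbb lb)
    moreover have "(\<integral>s. (g s - poly p s)\<^sup>2 \<partial>M) < \<epsilon> / 4" "(\<integral>s. (h s - poly q s)\<^sup>2 \<partial>M) < \<epsilon> / 4"
      using pq that by auto
    moreover have "(g s - poly p s) + (h s - poly q s) = g s + h s - poly (p + q) s" for s
      by simp
    ultimately show ?thesis
      by simp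
  qed
  then show "\<exists>p. \<forall>M\<in>N. (\<integral>s. (g s + h s - poly p s)\<^sup>2 \<partial>M) < \<epsilon>" by blast
qed

lemma approximable_cmult:
  assumes a: "approximable N h"
  shows "approximable N (\<lambda>s. c * h s)"
  unfolding approximable_def
proof (intro allI impI)
  fix \<epsilon> :: real assume e: "\<epsilon> > 0"
  have c: "c\<^sup>2 + 1 > 0"
    by (simp add: add_nonneg_pos)
  then have "\<epsilon> / (c\<^sup>2 + 1) > 0" using e by simp
  with a obtain p where p: "\<forall>M\<in>N. (\<integral>s. (h s - poly p s)\<^sup>2 \<partial>M) < \<epsilon> / (c\<^sup>2 + 1)"
    unfolding approximable_def by blast
  have "(\<integral>s. (c * h s - poly (smult c p) s)\<^sup>2 \<partial>M) < \<epsilon>" if "M \<in> N" for M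
  proof -
    have "(\<integral>s. (c * h s - poly (smult c p) s)\<^sup>2 \<partial>M) = (\<integral>s. c\<^sup>2 * (h s - poly p s)\<^sup>2 \<partial>M)"
      by (simp add: power_mult_distrib[symmetric] right_diff_distrib)
    also have "\<dots> = c\<^sup>2 * (\<integral>s. (h s - poly p s)\<^sup>2 \<partial>M)"
      by simp
    also have "\<dots> \<le> c\<^sup>2 * (\<epsilon> / (c\<^sup>2 + 1))"
      using p that by (intro mult_left_mono) (auto intro: less_imp_le)
    also have "\<dots> < \<epsilon>"
      using c e by (simp add: field_simps)
    finally show ?thesis .
  qed
  then show "\<exists>p. \<forall>M\<in>N. (\<integral>s. (c * h s - poly p s)\<^sup>2 \<partial>M) < \<epsilon>" by blast
qed

lemma approximable_continuous:
  assumes h: "continuous_on UNIV h"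
  shows "approximable N h"
  unfolding approximable_def
proof (intro allI impI)
  fix \<epsilon> :: real assume "\<epsilon> > 0"
  define T where "T = (\<Sum>M\<in>N. measure M (space M))"
  have "T \<ge> 0" by (simp add: T_def sum_nonneg)
  \<comment> \<open>A uniform error \<open>e\<close> costs at most \<open>e\<^sup>2T\<close> in each of the integrals.\<close>
  define e where "e = sqrt (\<epsilon> / (T + 1))"
  have e: "e > 0" "e\<^sup>2 * T < \<epsilon>"
    using \<open>\<epsilon> > 0\<close> \<open>T \<ge> 0\<close> by (auto simp: e_def field_simps)
  obtain g where g: "real_polynomial_function g" "\<And>s. s \<in> {-K..K} \<Longrightarrow> \<bar>h s - g s\<bar> < e"
    using Stone_Weierstrass_real_polynomial_function[of "{-K..K}" h e] h e
    by (metis compact_Icc continuous_on_subset top_greatest)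
  obtain a n where gan: "g = (\<lambda>x. \<Sum>i\<le>n. a i * x ^ i)"
    using real_polynomial_function_imp_sum[OF g(1)] by auto
  define p where "p = (\<Sum>i\<le>(n::nat). monom (a i) i)"
  have gp: "poly p s = g s" for s
    by (simp add: gan p_def poly_sum poly_monom)
  have "(\<integral>s. (h s - poly p s)\<^sup>2 \<partial>M) < \<epsilon>" if M: "M \<in> N" for M
  proof -
    have "AE s in M. \<bar>s\<bar> \<le> K"
      using N[OF M] by (simp add: borel_measure_on_def)
    then have "AE s in M. (h s - poly p s)\<^sup>2 \<le> e\<^sup>2"
    proof eventually_elim
      case (elim s)
      then have "\<bar>h s - poly p s\<bar> < e"
        using g(2)[of s] by (simp add: gp abs_le_iff)
      then have "\<bar>h s - poly p s\<bar> \<le> \<bar>e\<bar>"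
        by linarith
      then show ?case by (simp add: abs_le_square_iff)
    qed
    then have "(\<integral>s. (h s - poly p s)\<^sup>2 \<partial>M) \<le> (\<integral>s. e\<^sup>2 \<partial>M)"
      by (intro integral_mono_lbb[OF N[OF M]] lbb lbb_continuous[OF h])
    also have "\<dots> = e\<^sup>2 * measure M (space M)"
      by simp
    also have "\<dots> \<le> e\<^sup>2 * T"
      unfolding T_def using finite_N M by (intro mult_left_mono member_le_sum) auto
    finally show ?thesis
      using e by simp
  qed
  then show "\<exists>p. \<forall>M\<in>N. (\<integral>s. (h s - poly p s)\<^sup>2 \<partial>M) < \<epsilon>" by blast
qed

lemma approximable_indicator_atMost: "approximable N (indicator {..a})"
proof (rule approximable_seq[where B = 1])
  let ?U = "\<lambda>(i::nat) s. max 0 (min 1 (1 - real i * (s - a)))"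
  show "approximable N (?U i)" for i
    by (intro approximable_continuous continuous_intros)
  show "?U i \<in> borel_measurable borel" for i
    by simp
  show "\<bar>?U i s\<bar> \<le> 1" for i s
    by auto
  show "(\<lambda>i. ?U i s) \<longlonglongrightarrow> indicator {..a} s" for s
  proof (cases "s \<le> a")
    case True
    have "?U i s = 1" for i
    proof -
      have "real i * (s - a) \<le> 0"
        using True by (intro mult_nonneg_nonpos) auto
      then show ?thesis
        by (auto simp: min_def max_def)
    qed
    then have "(\<lambda>i. ?U i s) = (\<lambda>i. 1)"
      by blast
    then show ?thesis
      using True by (simp only: tendsto_const indicator_simps atMost_iff if_True)
  next
    case False
    obtain m where m: "1 / (s - a) \<le> real m"
      using real_arch_simple by blast
    have "?U i s = 0" if "i \<ge> m" for i
    proof -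
      have "1 / (s - a) \<le> real i"
        using m that by linarith
      then have "1 \<le> real i * (s - a)"
        using False by (simp add: field_simps)
      then show ?thesis by simp
    qed
    then show ?thesis
      using False by (intro tendsto_eventually) (auto simp: eventually_sequentially)
  qed
qed

text \<open>The Borel sets with approximable indicator form a Dynkin system that contains the
  half-lines.\<close>

lemma approximable_indicator:
  assumes "A \<in> sets borel"
  shows "approximable N (indicator A)"
proof -
  let ?G = "range (\<lambda>a::real. {..a})"
  have borel: "sets borel = sigma_sets UNIV ?G"
    by (subst borel_eq_atMost) simp
  have "Int_stable ?G"
    by (auto simp: Int_stable_def intro!: image_eqI[of _ _ "min _ _"])
  moreover have "?G \<subseteq> Pow UNIV"
    by simp
  moreover have "A \<in> sigma_sets UNIV ?G"
    using assms borel by simp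
  ultimately show ?thesis
  proof (induction rule: sigma_sets_induct_disjoint)
    case (basic A)
    then show ?case
      using approximable_indicator_atMost by auto
  next
    case empty
    show ?case
      by (rule approximable_continuous) (simp add: indicator_def)
  next
    case (compl A)
    then have A: "A \<in> sets borel" using borel by simp
    have "approximable N (\<lambda>s. 1 + (- 1) * indicator A s)"
      by (intro approximable_add approximable_cmult compl.IH lbb A approximable_continuous
          continuous_intros)
    moreover have "(\<lambda>s. 1 + (- 1) * indicator A s) = (indicator (UNIV - A) :: real \<Rightarrow> real)"
      by (auto simp: indicator_def)
    ultimately show ?case by simp
  next
    case (union A)
    have A: "A i \<in> sets borel" for i
      using union(2) borel by auto
    let ?U = "\<lambda>n s. indicator (\<Union>i<n. A i) s :: real"
    have U: "approximable N (?U n)" for n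
    proof (induction n)
      case 0
      show ?case by (rule approximable_continuous) (simp add: indicator_def)
    next
      case (Suc n)
      have "approximable N (\<lambda>s. ?U n s + indicator (A n) s)"
        using A by (intro approximable_add Suc.IH union.IH lbb) auto
      moreover have "A n \<inter> A i = {}" if "i < n" for i
        using union(1) that by (auto simp: disjoint_family_on_def)
      then have "(\<lambda>s. ?U n s + indicator (A n) s) = ?U (Suc n)"
        by (fastforce simp: indicator_def lessThan_Suc fun_eq_iff)
      ultimately show ?case by simp
    qed
    show ?case
    proof (rule approximable_seq[where U = ?U and B = 1])
      show "?U n \<in> borel_measurable borel" for n
        using A by simp
      show "\<bar>?U n s\<bar> \<le> 1" for n s
        by (simp add: indicator_def)
      show "(\<lambda>n. ?U n s) \<longlonglongrightarrow> indicator (\<Union>i. A i) s" for s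
      proof (cases "s \<in> (\<Union>i. A i)")
        case True
        then obtain i where "s \<in> A i" by blast
        then have "?U n s = 1" if "n \<ge> Suc i" for n
          using that by (auto simp: indicator_def)
        then show ?thesis
          using True by (intro tendsto_eventually) (auto simp: eventually_sequentially)
      qed (simp add: indicator_def)
    qed (rule U)
  qed
qed

text \<open>Continuous functions are covered by the Weierstrass theorem; the approximable functions are
  closed under bounded pointwise limits of sequences, which leads from indicators of Borel sets
  to all bounded Borel functions.\<close>

theorem polynomials_dense:
  assumes h: "h \<in> borel_measurable borel" and B: "\<And>s. \<bar>h s\<bar> \<le> B"
  shows "approximable N h"
proof -
  have nonneg: "(\<forall>C. (\<forall>s. u s \<le> C) \<longrightarrow> approximable N u)"
    if "u \<in> borel_measurable borel" "\<And>s. 0 \<le> u s" for u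
    using that
  proof (induction u rule: borel_measurable_induct_real)
    case (set A)
    then show ?case
      using approximable_indicator by auto
  next
    case (mult u c)
    show ?case
    proof (intro allI impI)
      fix C assume C: "\<forall>s. c * u s \<le> C"
      show "approximable N (\<lambda>s. c * u s)"
      proof (cases "c = 0")
        case True
        then show ?thesis
          by (intro approximable_continuous) simp
      next
        case False
        then have "\<forall>s. u s \<le> C / c"
          using mult.hyps(1) C by (simp add: field_simps)
        then show ?thesis
          using mult.IH by (intro approximable_cmult) blast
      qed
    qed
  next
    case (add u v)
    show ?case
    proof (intro allI impI)
      fix C assume C: "\<forall>s. v s + u s \<le> C"
      then have uv: "u s \<le> C" "v s \<le> C" for s
      proof -
        have "0 \<le> u s" "0 \<le> v s" "v s + u s \<le> C"
          using add.hyps(2,4) C by blast+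
        then show "u s \<le> C" "v s \<le> C"
          by linarith+
      qed
      then have "approximable N u" "approximable N v"
        using add.IH by blast+
      moreover have "locally_bounded_borel u" "locally_bounded_borel v"
        using uv add.hyps(1-4) by (auto intro!: lbb_bounded[where B = C])
      ultimately show "approximable N (\<lambda>s. v s + u s)"
        by (intro approximable_add)
    qed
  next
    case (seq U)
    show ?case
    proof (intro allI impI)
      fix C assume C: "\<forall>s. u s \<le> C"
      have lim: "(\<lambda>i. U i s) \<longlonglongrightarrow> u s" for s
        using seq.hyps(4) by simp
      have "incseq (\<lambda>i. U i s)" for s
        using seq.hyps(3) by (auto simp: incseq_def le_fun_def)
      then have UC: "U i s \<le> C" for i s
        using C incseq_le[OF _ lim[of s], of i] order_trans by blast
      show "approximable N u"
      proof (rule approximable_seq[where U = U and B = C])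
        show "\<bar>U i s\<bar> \<le> C" for i s
          using UC[of i s] seq.hyps(2)[of i s] by simp
        show "approximable N (U i)" for i
          using seq.IH UC by blast
      qed (use seq.hyps(1) lim in simp_all)
    qed
  qed
  have hB: "0 \<le> h s + B" "h s + B \<le> 2 * B" for s
    using B[of s] by linarith+
  have "approximable N (\<lambda>s. h s + B)"
    using nonneg[of "\<lambda>s. h s + B", OF borel_measurable_add[OF h borel_measurable_const] hB(1)] hB(2)
    by blast
  then have "approximable N (\<lambda>s. (h s + B) + (- B))"
    by (intro approximable_add[OF lbb_add[OF lbb_bounded[OF h B] lbb_const] lbb_const]
        approximable_continuous[OF continuous_on_const])
  then show ?thesis by simp
qed

end

text \<open>A substitute for the Cauchy--Schwarz inequality in \<open>L\<^sup>2(M)\<close>: integrate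
  \<open>|uq| \<le> u\<^sup>2/\<epsilon> + \<epsilon>q\<^sup>2\<close>.\<close>

lemma integral_pairing_small:
  assumes M: "borel_measure_on K M" and lb: "locally_bounded_borel u" "locally_bounded_borel q"
    and e: "\<epsilon> > 0" "(\<integral>s. (u s)\<^sup>2 \<partial>M) < \<epsilon>\<^sup>2"
  shows "\<bar>\<integral>s. u s * q s \<partial>M\<bar> \<le> \<epsilon> * ((\<integral>s. (q s)\<^sup>2 \<partial>M) + 1)"
proof -
  have "\<bar>u s * q s\<bar> \<le> (1 / \<epsilon>) * (u s)\<^sup>2 + \<epsilon> * (q s)\<^sup>2" for s
  proof -
    have "2 * (\<bar>u s\<bar> * (\<epsilon> * \<bar>q s\<bar>)) \<le> (u s)\<^sup>2 + \<epsilon>\<^sup>2 * (q s)\<^sup>2"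
      using zero_le_power2[of "\<bar>u s\<bar> - \<epsilon> * \<bar>q s\<bar>"]
      by (simp add: power2_diff power_mult_distrib mult_ac)
    moreover have "0 \<le> \<bar>u s\<bar> * (\<epsilon> * \<bar>q s\<bar>)"
      using e(1) by simp
    ultimately have "\<bar>u s\<bar> * (\<epsilon> * \<bar>q s\<bar>) \<le> (u s)\<^sup>2 + \<epsilon>\<^sup>2 * (q s)\<^sup>2"
      by linarith
    then have "\<epsilon> * \<bar>u s * q s\<bar> \<le> (u s)\<^sup>2 + \<epsilon>\<^sup>2 * (q s)\<^sup>2"
      by (simp add: abs_mult mult_ac)
    then show ?thesis
      using e(1) by (simp add: field_simps power2_eq_square)
  qed
  then have "(\<integral>s. \<bar>u s * q s\<bar> \<partial>M) \<le> (\<integral>s. (1 / \<epsilon>) * (u s)\<^sup>2 + \<epsilon> * (q s)\<^sup>2 \<partial>M)"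
    by (intro integral_mono_lbb[OF M] lbb lb AE_I2)
  also have "\<dots> = (1 / \<epsilon>) * (\<integral>s. (u s)\<^sup>2 \<partial>M) + \<epsilon> * (\<integral>s. (q s)\<^sup>2 \<partial>M)"
  proof -
    have "integrable M (\<lambda>s. (u s)\<^sup>2)" "integrable M (\<lambda>s. (q s)\<^sup>2)"
      by (intro integrable_lbb[OF M] lbb lb)+
    then show ?thesis by simp
  qed
  also have "(1 / \<epsilon>) * (\<integral>s. (u s)\<^sup>2 \<partial>M) \<le> (1 / \<epsilon>) * \<epsilon>\<^sup>2"
    using e by (intro mult_left_mono) auto
  also have "(1 / \<epsilon>) * \<epsilon>\<^sup>2 + \<epsilon> * (\<integral>s. (q s)\<^sup>2 \<partial>M) = \<epsilon> * ((\<integral>s. (q s)\<^sup>2 \<partial>M) + 1)"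
    using e by (simp add: power2_eq_square distrib_left)
  finally show ?thesis
    using integral_abs_bound[of M "\<lambda>s. u s * q s"] by linarith
qed

lemma integral_poly:
  assumes M: "borel_measure_on K M"
  shows "(\<integral>s. poly p s \<partial>M) = (\<Sum>i\<le>degree p. coeff p i * (\<integral>s. s ^ i \<partial>M))"
proof -
  have "(\<integral>s. poly p s \<partial>M) = (\<integral>s. (\<Sum>i\<le>degree p. coeff p i * s ^ i) \<partial>M)"
    by (simp add: poly_altdef)
  also have "\<dots> = (\<Sum>i\<le>degree p. (\<integral>s. coeff p i * s ^ i \<partial>M))"
    by (intro Bochner_Integration.integral_sum integrable_lbb[OF M] lbb)
  finally show ?thesis by simp
qed

text \<open>Approximate the indicator of a Borel set by one polynomial in both \<open>L\<^sup>2\<close> spaces; the two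
  integrals of that polynomial agree.\<close>

theorem measure_eqI_moments:
  assumes M: "borel_measure_on K M" and M': "borel_measure_on K M'"
    and moments: "\<And>n. (\<integral>s. s ^ n \<partial>M) = (\<integral>s. s ^ n \<partial>M')"
  shows "M = M'"
proof (rule measure_eqI)
  have sets: "sets M = sets borel" "sets M' = sets borel"
    using M M' by (auto simp: borel_measure_on_def)
  then show "sets M = sets M'" by simp
  interpret M: finite_measure M using M by (simp add: borel_measure_on_def)
  interpret M': finite_measure M' using M' by (simp add: borel_measure_on_def)
  fix A assume "A \<in> sets M"
  then have A: "A \<in> sets borel" using sets by simp
  define c where "c = measure M UNIV + measure M' UNIV + 2"
  have space: "space M = UNIV" "space M' = UNIV"
    using sets[THEN sets_eq_imp_space_eq] by simp_all
  have "\<bar>measure M A - measure M' A\<bar> \<le> 0 + \<epsilon>" if "\<epsilon> > 0" for \<epsilon>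
  proof -
    have "c > 0" by (simp add: c_def add_nonneg_pos)
    define e where "e = \<epsilon> / c"
    have e: "e > 0" using \<open>c > 0\<close> that by (simp add: e_def)
    have "approximable {M, M'} (indicator A)"
      using M M' by (intro approximable_indicator[where K = K] A) auto
    then obtain p where p: "(\<integral>s. (indicator A s - poly p s)\<^sup>2 \<partial>M) < e\<^sup>2"
        "(\<integral>s. (indicator A s - poly p s)\<^sup>2 \<partial>M') < e\<^sup>2"
      using e unfolding approximable_def by (metis insertI1 insertI2 zero_less_power)
    have 1: "\<bar>measure M A - (\<integral>s. poly p s \<partial>M)\<bar> \<le> e * (measure M UNIV + 1)"
      using integral_pairing_small[OF M _ lbb_const[of 1] e p(1)] A sets
      by (simp add: lbb Bochner_Integration.integral_diff integrable_lbb[OF M] space)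
    have 2: "\<bar>measure M' A - (\<integral>s. poly p s \<partial>M')\<bar> \<le> e * (measure M' UNIV + 1)"
      using integral_pairing_small[OF M' _ lbb_const[of 1] e p(2)] A sets
      by (simp add: lbb Bochner_Integration.integral_diff integrable_lbb[OF M'] space)
    have "(\<integral>s. poly p s \<partial>M) = (\<integral>s. poly p s \<partial>M')"
      by (simp add: integral_poly[OF M] integral_poly[OF M'] moments)
    with 1 2 have "\<bar>measure M A - measure M' A\<bar> \<le> e * c"
      by (simp add: c_def distrib_left)
    then show ?thesis
      using \<open>c > 0\<close> by (simp add: e_def)
  qed
  then have "\<bar>measure M A - measure M' A\<bar> \<le> 0"
    by (rule field_le_epsilon)
  then show "emeasure M A = emeasure M' A"
    by (simp add: M.emeasure_eq_measure M'.emeasure_eq_measure)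
qed

text \<open>By density the hypothesis extends from squares of polynomials to the indicator \<open>h\<close> of
  \<open>{w < 0}\<close>, for which the integral of \<open>h\<^sup>2w\<close> can only be nonnegative if \<open>{w < 0}\<close> is a null
  set.\<close>

lemma AE_nonneg_if_square_integrals_nonneg:
  assumes M: "borel_measure_on K M" and w: "locally_bounded_borel w"
    and pos: "\<And>p. 0 \<le> (\<integral>s. (poly p s)\<^sup>2 * w s \<partial>M)"
  shows "AE s in M. 0 \<le> w s"
proof -
  have [measurable]: "w \<in> borel_measurable borel"
    using w by (rule lbb_measurable)
  obtain W0 where W0: "\<And>s. \<bar>s\<bar> \<le> K \<Longrightarrow> \<bar>w s\<bar> \<le> W0"
    using w by (auto simp: locally_bounded_borel_def)
  define W where "W = \<bar>W0\<bar>"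
  have W: "W \<ge> 0" "AE s in M. \<bar>w s\<bar> \<le> W"
    using M W0 by (fastforce simp: W_def borel_measure_on_def)+
  let ?A = "{s. w s < 0}"
  have A: "?A \<in> sets borel" by measurable
  define h :: "real \<Rightarrow> real" where "h = indicator ?A"
  have h: "locally_bounded_borel h"
    unfolding h_def using A by (rule lbb)
  define c where "c = (\<integral>s. (h s)\<^sup>2 \<partial>M)"
  have "c \<ge> 0" by (simp add: c_def)
  have bound: "- (W * (\<epsilon> * (c + 2))) \<le> (\<integral>s. (h s)\<^sup>2 * w s \<partial>M)" if e: "0 < \<epsilon>" "\<epsilon> \<le> 1" for \<epsilon>
  proof -
    have "approximable {M} h"
      unfolding h_def using M by (intro approximable_indicator[where K = K] A) auto
    then obtain p where p: "(\<integral>s. (h s - poly p s)\<^sup>2 \<partial>M) < \<epsilon>\<^sup>2"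
      using e unfolding approximable_def by (metis insertI1 zero_less_power)
    have "AE s in M. (poly p s)\<^sup>2 * w s
       \<le> (h s)\<^sup>2 * w s + W * ((1 + 1 / \<epsilon>) * (h s - poly p s)\<^sup>2 + \<epsilon> * (h s)\<^sup>2)"
      using W(2)
    proof eventually_elim
      case (elim s)
      \<comment> \<open>The estimate rests on \<open>p\<^sup>2 - h\<^sup>2 = d\<^sup>2 + 2dh\<close> with \<open>2|dh| \<le> d\<^sup>2/\<epsilon> + \<epsilon>h\<^sup>2\<close>.\<close>
      define d where "d = poly p s - h s"
      have "2 * (\<bar>d\<bar> * (\<epsilon> * \<bar>h s\<bar>)) \<le> d\<^sup>2 + \<epsilon>\<^sup>2 * (h s)\<^sup>2"
        using zero_le_power2[of "\<bar>d\<bar> - \<epsilon> * \<bar>h s\<bar>"]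
        by (simp add: power2_diff power_mult_distrib mult_ac)
      then have "2 * \<bar>d * h s\<bar> \<le> (1 / \<epsilon>) * d\<^sup>2 + \<epsilon> * (h s)\<^sup>2"
        using e by (simp add: field_simps power2_eq_square abs_mult)
      moreover have "(poly p s)\<^sup>2 - (h s)\<^sup>2 = d\<^sup>2 + 2 * (d * h s)"
        by (simp add: d_def power2_eq_square algebra_simps)
      then have "\<bar>(poly p s)\<^sup>2 - (h s)\<^sup>2\<bar> \<le> d\<^sup>2 + 2 * \<bar>d * h s\<bar>"
        using abs_triangle_ineq[of "d\<^sup>2" "2 * (d * h s)"] by (simp add: abs_mult)
      ultimately have "\<bar>(poly p s)\<^sup>2 - (h s)\<^sup>2\<bar> \<le> (1 + 1 / \<epsilon>) * d\<^sup>2 + \<epsilon> * (h s)\<^sup>2"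
        unfolding distrib_right by linarith
      then have "\<bar>(poly p s)\<^sup>2 - (h s)\<^sup>2\<bar> * \<bar>w s\<bar> \<le> ((1 + 1 / \<epsilon>) * d\<^sup>2 + \<epsilon> * (h s)\<^sup>2) * W"
        using elim e by (intro mult_mono) auto
      moreover have "(poly p s)\<^sup>2 * w s - (h s)\<^sup>2 * w s \<le> \<bar>(poly p s)\<^sup>2 - (h s)\<^sup>2\<bar> * \<bar>w s\<bar>"
        by (metis abs_ge_self abs_mult left_diff_distrib)
      moreover have "d\<^sup>2 = (h s - poly p s)\<^sup>2"
        by (simp add: d_def power2_commute)
      ultimately show ?case
        by (simp add: mult.commute)
    qed
    then have "(\<integral>s. (poly p s)\<^sup>2 * w s \<partial>M)
        \<le> (\<integral>s. (h s)\<^sup>2 * w s + W * ((1 + 1 / \<epsilon>) * (h s - poly p s)\<^sup>2 + \<epsilon> * (h s)\<^sup>2) \<partial>M)"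
      by (intro integral_mono_lbb[OF M] lbb h w)
    also have "\<dots> = (\<integral>s. (h s)\<^sup>2 * w s \<partial>M)
        + W * ((1 + 1 / \<epsilon>) * (\<integral>s. (h s - poly p s)\<^sup>2 \<partial>M) + \<epsilon> * c)"
    proof -
      have i: "integrable M (\<lambda>s. (h s)\<^sup>2 * w s)" "integrable M (\<lambda>s. (h s - poly p s)\<^sup>2)"
        "integrable M (\<lambda>s. (h s)\<^sup>2)"
        by (intro integrable_lbb[OF M] lbb h w)+
      show ?thesis
        using i by (simp add: c_def)
    qed
    also have "(1 + 1 / \<epsilon>) * (\<integral>s. (h s - poly p s)\<^sup>2 \<partial>M) \<le> (1 + 1 / \<epsilon>) * \<epsilon>\<^sup>2"
      using p e by (intro mult_left_mono) auto
    also have "(1 + 1 / \<epsilon>) * \<epsilon>\<^sup>2 \<le> \<epsilon> * 2"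
      using e by (simp add: power2_eq_square field_simps)
    finally have "(\<integral>s. (poly p s)\<^sup>2 * w s \<partial>M) \<le> (\<integral>s. (h s)\<^sup>2 * w s \<partial>M) + W * (\<epsilon> * 2 + \<epsilon> * c)"
      using W(1) by (simp add: mult_left_mono)
    then show ?thesis
      using pos[of p] by (simp add: algebra_simps)
  qed
  have "((\<lambda>\<epsilon>. - (W * (\<epsilon> * (c + 2)))) \<longlongrightarrow> - (W * (0 * (c + 2)))) (at_right 0)"
    by (intro tendsto_intros)
  moreover have "\<forall>\<^sub>F \<epsilon> in at_right 0. - (W * (\<epsilon> * (c + 2))) \<le> (\<integral>s. (h s)\<^sup>2 * w s \<partial>M)"
    using bound by (intro eventually_at_rightI[of 0 1]) auto
  ultimately have "- (W * (0 * (c + 2))) \<le> (\<integral>s. (h s)\<^sup>2 * w s \<partial>M)"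
    by (rule tendsto_upperbound) simp
  then have "0 \<le> (\<integral>s. (h s)\<^sup>2 * w s \<partial>M)"
    by simp
  have nonneg: "0 \<le> - ((h s)\<^sup>2 * w s)" for s
    by (simp add: h_def indicator_def)
  have int: "integrable M (\<lambda>s. (h s)\<^sup>2 * w s)"
    by (intro integrable_lbb[OF M] lbb h w)
  have "0 \<le> (\<integral>s. - ((h s)\<^sup>2 * w s) \<partial>M)"
    by (intro integral_nonneg_AE AE_I2 nonneg)
  with \<open>0 \<le> (\<integral>s. (h s)\<^sup>2 * w s \<partial>M)\<close> have "(\<integral>s. - ((h s)\<^sup>2 * w s) \<partial>M) = 0"
    unfolding integral_minus by linarith
  then have "AE s in M. - ((h s)\<^sup>2 * w s) = 0"
    using nonneg integral_nonneg_eq_0_iff_AE[OF integrable_minus[OF int]] by simp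
  then show ?thesis
    by eventually_elim (auto simp: h_def indicator_def split: if_splits)
qed

section \<open>The Hausdorff moment problem\<close>

definition bernstein_poly :: "nat \<Rightarrow> nat \<Rightarrow> real poly" where
  "bernstein_poly k j = smult (real (k choose j)) ([:0, 1:] ^ j * [:1, -1:] ^ (k - j))"

text \<open>Replacing the powers \<open>(j/k)\<^sup>n\<close> by ratios of binomial coefficients turns the Bernstein
  approximation of \<open>x\<^sup>n\<close> into an exact identity, the binomial expansion of
  \<open>x\<^sup>n (x + (1 - x))\<^bsup>k - n\<^esup>\<close>.\<close>

lemma choose_weighted_bernstein_sum:
  assumes "n \<le> k"
  shows "(\<Sum>j\<le>k. smult (real (j choose n) / real (k choose n)) (bernstein_poly k j)) = [:0, 1:] ^ n"
proof (subst poly_eq_poly_eq_iff[symmetric], rule ext)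
  fix x :: real
  let ?t = "\<lambda>j. real (j choose n) * real (k choose j) * (x ^ j * (1 - x) ^ (k - j))"
  have "(\<Sum>j\<le>k. ?t j) = (\<Sum>j\<in>{n..k}. ?t j)"
    by (intro sum.mono_neutral_right) auto
  also have "\<dots> = (\<Sum>i\<le>k - n. ?t (i + n))"
    using assms by (intro sum.reindex_bij_witness[of _ "\<lambda>i. i + n" "\<lambda>j. j - n"]) auto
  also have "\<dots> = (\<Sum>i\<le>k - n. real (k choose n) * x ^ n
      * (real ((k - n) choose i) * x ^ i * (1 - x) ^ (k - n - i)))"
  proof (intro sum.cong refl)
    fix i assume "i \<in> {..k - n}"
    then have "(k choose (i + n)) * ((i + n) choose n) = (k choose n) * ((k - n) choose i)"
      using choose_mult[of n "i + n" k] assms by simp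
    then have "real (k choose (i + n)) * real ((i + n) choose n)
        = real (k choose n) * real ((k - n) choose i)"
      by (metis of_nat_mult)
    then have "real ((i + n) choose n) * real (k choose (i + n))
        = real (k choose n) * real ((k - n) choose i)"
      by (simp only: mult.commute)
    moreover have "k - (i + n) = k - n - i"
      by simp
    ultimately show "?t (i + n) = real (k choose n) * x ^ n
      * (real ((k - n) choose i) * x ^ i * (1 - x) ^ (k - n - i))"
      by (simp add: power_add mult_ac)
  qed
  also have "\<dots> = real (k choose n) * x ^ n * (x + (1 - x)) ^ (k - n)"
    by (subst binomial_ring) (simp add: sum_distrib_left)
  finally have "(\<Sum>j\<le>k. ?t j) = real (k choose n) * x ^ n"
    by simp
  moreover have "real (k choose n) \<noteq> 0"
    using assms by simp
  moreover have "poly (\<Sum>j\<le>k. smult (real (j choose n) / real (k choose n)) (bernstein_poly k j)) x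
      = (\<Sum>j\<le>k. ?t j) / real (k choose n)"
    by (simp add: poly_sum bernstein_poly_def sum_divide_distrib)
  ultimately show "poly (\<Sum>j\<le>k. smult (real (j choose n) / real (k choose n)) (bernstein_poly k j)) x
      = poly ([:0, 1:] ^ n) x"
    by simp
qed

text \<open>The ratio is a product of \<open>n\<close> factors \<open>(j - i)/(k - i)\<close>, each of modulus at most \<open>1\<close> and
  close to \<open>j/k\<close>. The point is that the bound does not depend on \<open>j\<close>.\<close>

lemma choose_ratio_close:
  assumes "2 * n \<le> k" "0 < k" "j \<le> k"
  shows "\<bar>(real j / real k) ^ n - real (j choose n) / real (k choose n)\<bar> \<le> real n * (real n / real (k - n))"
proof -
  have ratio: "real (j choose n) / real (k choose n)
      = (\<Prod>i = 0..<n. (real j - real i) / (real k - real i))"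
    by (simp add: binomial_gbinomial gbinomial_prod_rev prod_dividef)
  have close: "\<bar>real j / real k - (real j - real i) / (real k - real i)\<bar> \<le> real n / real (k - n)
      \<and> \<bar>(real j - real i) / (real k - real i)\<bar> \<le> 1"
    if "i < n" for i
  proof -
    have pos: "real k - real i > 0" "real k > 0" "real (k - n) = real k - real n"
      using assms that by linarith+
    have "real j / real k - (real j - real i) / (real k - real i)
        = real i * (real k - real j) / (real k * (real k - real i))"
      using pos by (simp add: field_simps)
    also have "\<bar>\<dots>\<bar> = (real i / (real k - real i)) * ((real k - real j) / real k)"
      using pos assms by (simp add: abs_mult)
    also have "\<dots> \<le> (real i / (real k - real i)) * 1"
      using pos assms by (intro mult_left_mono) (auto simp: field_simps)
    also have "\<dots> \<le> real n / real (k - n)"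
      using pos assms that by (auto intro!: frac_le)
    finally show ?thesis
      using pos assms that by (simp add: abs_le_iff field_simps)
  qed
  have "norm ((\<Prod>i = 0..<n. real j / real k) - (\<Prod>i = 0..<n. (real j - real i) / (real k - real i)))
      \<le> (\<Sum>i = 0..<n. norm (real j / real k - (real j - real i) / (real k - real i)))"
    using close assms by (intro norm_prod_diff) auto
  also have "\<dots> \<le> (\<Sum>i = 0..<n. real n / real (k - n))"
    using close by (intro sum_mono) auto
  finally show ?thesis
    by (simp add: ratio)
qed

text \<open>The measure with mass \<open>L(b\<^sub>k\<^sub>j)\<close> at \<open>j/k\<close>, where \<open>b\<^sub>k\<^sub>j\<close> are the Bernstein polynomials of
  degree \<open>k\<close>, is a probability measure on \<open>[0, 1]\<close> whose \<open>n\<close>-th moment differs from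
  \<open>L(x\<^sup>n)\<close> by \<open>O(1/k)\<close> according to the two preceding lemmas. Any weak limit point solves the
  problem; as weak convergence only tests bounded functions, the powers are first cut off
  outside \<open>[0, 1]\<close>.\<close>

theorem hausdorff_moment_problem:
  fixes L :: "real poly \<Rightarrow> real"
  assumes L_add: "\<And>p q. L (p + q) = L p + L q"
    and L_smult: "\<And>c p. L (smult c p) = c * L p"
    and L_pos: "\<And>i j. 0 \<le> L ([:0, 1:] ^ i * [:1, -1:] ^ j)"
    and L_1: "L 1 = 1"
  obtains M where "real_distribution M" "AE s in M. 0 \<le> s \<and> s \<le> 1"
    "\<And>p. L p = (\<integral>s. poly p s \<partial>M)"
proof -
  have L_0: "L 0 = 0"
    using L_smult[of 0 0] by simp
  have L_sum: "L (\<Sum>i\<in>I. p i) = (\<Sum>i\<in>I. L (p i))" for p :: "nat \<Rightarrow> real poly" and I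
    by (induction I rule: infinite_finite_induct) (auto simp: L_0 L_add)
  define W where "W k j = L (bernstein_poly k j)" for k j
  have W_nonneg: "0 \<le> W k j" for k j
    by (simp add: W_def bernstein_poly_def L_smult L_pos)
  have W_moment: "(\<Sum>j\<le>k. real (j choose n) / real (k choose n) * W k j) = L ([:0, 1:] ^ n)"
    if "n \<le> k" for n k
    by (simp add: choose_weighted_bernstein_sum[OF that, symmetric] L_sum L_smult W_def)
  have W_1: "(\<Sum>j\<le>k. W k j) = 1" for k
    using W_moment[of 0 k] L_1 by simp
  define M where "M k = distr (point_measure {..k} (W k)) borel (\<lambda>j. real j / real k)" for k
  have M_distribution: "real_distribution (M k)" for k
  proof -
    interpret P: prob_space "point_measure {..k} (W k)"
      using W_nonneg W_1 by (intro prob_space_point_measure) auto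
    show ?thesis
      unfolding M_def by (intro P.real_distribution_distr) simp
  qed
  have M_integral: "(\<integral>s. g s \<partial>M k) = (\<Sum>j\<le>k. W k j * g (real j / real k))"
    if g: "g \<in> borel_measurable borel" for g :: "real \<Rightarrow> real" and k
    unfolding M_def using g W_nonneg
    by (subst integral_distr) (auto simp: lebesgue_integral_point_measure_finite)
  have unit: "0 \<le> real j / real k" "real j / real k \<le> 1" if "j \<le> k" for j k :: nat
    using that by (auto simp: divide_le_eq_1)
  have "measure (M k) {-1<..1} = 1" for k
  proof -
    interpret real_distribution "M k" by (rule M_distribution)
    have "measure (M k) {-1<..1} = (\<integral>s. indicator {-1<..1} s \<partial>M k)"
      by simp
    also have "\<dots> = (\<Sum>j\<le>k. W k j * indicator {-1<..1} (real j / real k))"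
      by (rule M_integral) simp
    also have "\<dots> = (\<Sum>j\<le>k. W k j)"
      using unit by (intro sum.cong) (auto simp: indicator_def intro: less_le_trans[of "-1" 0])
    finally show ?thesis by (simp add: W_1)
  qed
  then have "tight M"
    unfolding tight_def using M_distribution
    by (intro conjI allI impI exI[of _ "-1"] exI[of _ 1]) simp_all
  then obtain r \<mu> where r: "strict_mono r" and \<mu>: "real_distribution \<mu>"
      and weak: "weak_conv_m (M \<circ> r) \<mu>"
    using tight_imp_convergent_subsubsequence[OF _ strict_mono_id, of M] unfolding comp_id
    by blast
  have conv: "(\<lambda>k. \<Sum>j\<le>r k. W (r k) j * g (real j / real (r k))) \<longlonglongrightarrow> (\<integral>s. g s \<partial>\<mu>)"
    if g: "continuous_on UNIV g" "\<And>s. \<bar>g s\<bar> \<le> B" for g :: "real \<Rightarrow> real" and B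
  proof -
    have "(\<lambda>k. integral\<^sup>L ((M \<circ> r) k) g) \<longlonglongrightarrow> integral\<^sup>L \<mu> g"
      using M_distribution \<mu> weak g
      by (intro weak_conv_imp_integral_bdd_continuous_conv[where B = B])
        (auto simp: continuous_on_eq_continuous_at comp_def)
    moreover have "integral\<^sup>L ((M \<circ> r) k) g = (\<Sum>j\<le>r k. W (r k) j * g (real j / real (r k)))" for k
      using M_integral[OF borel_measurable_continuous_onI[OF g(1)], of "r k"] by simp
    ultimately show ?thesis by simp
  qed
  interpret real_distribution \<mu> by (rule \<mu>)
  define clamp :: "real \<Rightarrow> real" where "clamp s = max 0 (min 1 s)" for s
  have clamp_cont: "continuous_on UNIV clamp"
    unfolding clamp_def by (intro continuous_intros)
  have clamp_bounds: "0 \<le> clamp s" "clamp s \<le> 1" for s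
    by (auto simp: clamp_def)
  have clamp_id: "clamp (real j / real k) = real j / real k" if "j \<le> k" for j k :: nat
    using unit[OF that] by (simp add: clamp_def)
  have supp: "AE s in \<mu>. 0 \<le> s \<and> s \<le> 1"
  proof -
    let ?g = "\<lambda>s. min 1 \<bar>s - clamp s\<bar>"
    have g: "continuous_on UNIV ?g" "\<And>s. \<bar>?g s\<bar> \<le> 1"
      using clamp_cont by (auto intro!: continuous_intros)
    have "(\<lambda>k. \<Sum>j\<le>r k. W (r k) j * ?g (real j / real (r k))) = (\<lambda>k. 0)"
      by (intro ext sum.neutral) (auto simp: clamp_id)
    then have "(\<integral>s. ?g s \<partial>\<mu>) = 0"
      using conv[OF g] by (simp add: LIMSEQ_const_iff)
    moreover have "integrable \<mu> ?g"
      using g borel_measurable_continuous_onI[OF g(1)]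
      by (intro integrable_const_bound[where B = 1]) auto
    ultimately have "AE s in \<mu>. ?g s = 0"
      by (subst integral_nonneg_eq_0_iff_AE[symmetric]) auto
    then show ?thesis
      by eventually_elim (auto simp: clamp_def max_def min_def split: if_splits)
  qed
  have moment: "L ([:0, 1:] ^ n) = (\<integral>s. s ^ n \<partial>\<mu>)" for n
  proof -
    have "(\<lambda>k. \<Sum>j\<le>r k. W (r k) j * clamp (real j / real (r k)) ^ n) \<longlonglongrightarrow> (\<integral>s. clamp s ^ n \<partial>\<mu>)"
    proof (rule conv[where B = 1])
      show "continuous_on UNIV (\<lambda>s. clamp s ^ n)"
        by (intro continuous_intros clamp_cont)
      show "\<bar>clamp s ^ n\<bar> \<le> 1" for s
        using clamp_bounds[of s] by (simp add: power_abs power_le_one)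
    qed
    moreover have "(\<lambda>k. (\<Sum>j\<le>r k. W (r k) j * clamp (real j / real (r k)) ^ n) - L ([:0, 1:] ^ n)) \<longlonglongrightarrow> 0"
    proof (rule Lim_null_comparison)
      have "(\<lambda>k. real n * (real n / real (k - n))) \<longlonglongrightarrow> 0"
      proof -
        have "(\<lambda>k. real n * (real n / real k)) \<longlonglongrightarrow> real n * 0"
          by (intro tendsto_mult tendsto_const lim_const_over_n)
        then have "(\<lambda>k. real n * (real n / real (k + n - n))) \<longlonglongrightarrow> 0"
          by simp
        then show ?thesis
          by (rule LIMSEQ_offset)
      qed
      then show "(\<lambda>k. real n * (real n / real (r k - n))) \<longlonglongrightarrow> 0"
        using LIMSEQ_subseq_LIMSEQ[OF _ r] by (fastforce simp: comp_def)
      show "\<forall>\<^sub>F k in sequentially.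
        norm ((\<Sum>j\<le>r k. W (r k) j * clamp (real j / real (r k)) ^ n) - L ([:0, 1:] ^ n))
          \<le> real n * (real n / real (r k - n))"
        using eventually_ge_at_top[of "2 * n + 1"]
      proof eventually_elim
        case (elim m)
        define k where "k = r m"
        have k: "2 * n \<le> k" "0 < k" "n \<le> k"
          using elim strict_mono_imp_increasing[OF r, of m] by (auto simp: k_def)
        have "(\<Sum>j\<le>k. W k j * clamp (real j / real k) ^ n) - L ([:0, 1:] ^ n)
            = (\<Sum>j\<le>k. W k j * ((real j / real k) ^ n - real (j choose n) / real (k choose n)))"
          by (simp add: W_moment[OF k(3), symmetric] clamp_id right_diff_distrib
              sum_subtractf mult.commute)
        also have "\<bar>\<dots>\<bar> \<le> (\<Sum>j\<le>k. \<bar>W k j * ((real j / real k) ^ n - real (j choose n) / real (k choose n))\<bar>)"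
          by (rule sum_abs)
        also have "\<dots> \<le> (\<Sum>j\<le>k. W k j * (real n * (real n / real (k - n))))"
          unfolding abs_mult using choose_ratio_close[OF k(1,2)] W_nonneg
          by (intro sum_mono mult_mono) auto
        also have "\<dots> = (\<Sum>j\<le>k. W k j) * (real n * (real n / real (k - n)))"
          by (rule sum_distrib_right[symmetric])
        finally show ?case
          by (simp add: W_1 k_def)
      qed
    qed
    then have "(\<lambda>k. \<Sum>j\<le>r k. W (r k) j * clamp (real j / real (r k)) ^ n) \<longlonglongrightarrow> L ([:0, 1:] ^ n)"
      by (rule LIM_zero_cancel)
    ultimately have "L ([:0, 1:] ^ n) = (\<integral>s. clamp s ^ n \<partial>\<mu>)"
      using LIMSEQ_unique by blast
    also have "\<dots> = (\<integral>s. s ^ n \<partial>\<mu>)"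
      using supp borel_measurable_continuous_onI[OF clamp_cont]
      by (intro integral_cong_AE) (auto simp: clamp_def)
    finally show ?thesis .
  qed
  have on: "borel_measure_on 1 \<mu>"
    unfolding borel_measure_on_def using supp finite_measure_axioms by auto
  have "L p = (\<integral>s. poly p s \<partial>\<mu>)" for p
  proof -
    have "p = (\<Sum>i\<le>degree p. smult (coeff p i) ([:0, 1:] ^ i))"
      using poly_as_sum_of_monoms[of p] by (simp add: monom_altdef)
    then have "L p = L (\<Sum>i\<le>degree p. smult (coeff p i) ([:0, 1:] ^ i))"
      by simp
    also have "\<dots> = (\<Sum>i\<le>degree p. coeff p i * (\<integral>s. s ^ i \<partial>\<mu>))"
      by (simp add: L_sum L_smult moment)
    finally show ?thesis
      by (simp add: integral_poly[OF on])
  qed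
  with \<mu> supp show thesis
    by (rule that)
qed

section \<open>Spectral measures\<close>

lemma Re_cinner_sandwich:
  assumes A: "self_adjoint A"
  shows "Re (cinner (poly_op A (q * q * r) *\<^sub>V x) x)
    = Re (cinner (poly_op A r *\<^sub>V poly_op A q *\<^sub>V x) (poly_op A q *\<^sub>V x))"
proof -
  have "poly_op A (q * q * r) = poly_op A (q * (r * q))"
    by (simp only: mult_ac)
  then show ?thesis
    by (simp only: cinner_poly_op_mult[OF A] poly_op_mult[of A r q] bop_times)
qed

text \<open>Even powers can be moved to the two sides of the inner product, which leaves the four
  products of \<open>S\<close> and \<open>1 - S\<close> with exponents \<open>0\<close> or \<open>1\<close>. The mixed one is
  \<open>S(1 - S) = S(1 - S)S + (1 - S)S(1 - S)\<close>, a sum of two positive operators.\<close>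

lemma bernstein_positive:
  assumes S: "self_adjoint S" and lower: "\<And>x. 0 \<le> Re (cinner (S *\<^sub>V x) x)"
    and upper: "\<And>x. Re (cinner (S *\<^sub>V x) x) \<le> (norm x)\<^sup>2"
  shows "0 \<le> Re (cinner (poly_op S ([:0, 1:] ^ i * [:1, -1:] ^ j) *\<^sub>V x) x)"
proof -
  let ?X = "[:0, 1:] :: real poly" and ?Y = "[:1, -1:] :: real poly"
  have X: "0 \<le> Re (cinner (poly_op S ?X *\<^sub>V y) y)" for y
    unfolding poly_op_X by (rule lower)
  have Y: "0 \<le> Re (cinner (poly_op S ?Y *\<^sub>V y) y)" for y
  proof -
    have "poly_op S ?Y = poly_op S (1 - ?X)"
      by (simp add: one_pCons)
    then show ?thesis
      using upper[of y]
      by (simp add: poly_op_minus bop_minus cinner_diff_left Re_cinner_self del: poly_op_pCons)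
  qed
  \<comment> \<open>Since \<open>?X + ?Y = 1\<close>.\<close>
  have "?X * ?Y = ?X * ?X * ?Y + ?Y * ?Y * ?X"
    by simp
  then have XY: "0 \<le> Re (cinner (poly_op S (?X * ?Y) *\<^sub>V y) y)" for y
    using Y X by (simp only: poly_op_add bop_plus cinner_add_left plus_complex.sel
        Re_cinner_sandwich[OF S] add_nonneg_nonneg)
  have "0 \<le> Re (cinner (poly_op S (?X ^ (i mod 2) * ?Y ^ (j mod 2)) *\<^sub>V y) y)" for y
  proof -
    have "i mod 2 = 0 \<or> i mod 2 = 1" "j mod 2 = 0 \<or> j mod 2 = 1"
      by auto
    then show ?thesis
      using X[of y] Y[of y] XY[of y]
      by (auto simp: Re_cinner_self simp del: poly_op_pCons mult_pCons_left mult_pCons_right)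
  qed
  moreover
  let ?q = "?X ^ (i div 2) * ?Y ^ (j div 2)"
  have "?X ^ i * ?Y ^ j = ?q * ?q * (?X ^ (i mod 2) * ?Y ^ (j mod 2))"
  proof -
    have "i = i div 2 + i div 2 + i mod 2" "j = j div 2 + j div 2 + j mod 2"
      by presburger+
    then have "?X ^ i * ?Y ^ j = ?X ^ (i div 2 + i div 2 + i mod 2) * ?Y ^ (j div 2 + j div 2 + j mod 2)"
      by metis
    then show ?thesis
      by (simp only: power_add mult_ac)
  qed
  ultimately show ?thesis
    by (simp only: Re_cinner_sandwich[OF S])
qed

lemma cinner_poly_op_real:
  assumes "self_adjoint A"
  shows "cinner (poly_op A p *\<^sub>V x) x = complex_of_real (Re (cinner (poly_op A p *\<^sub>V x) x))"
  using self_adjoint_Im[OF self_adjoint_poly_op[OF assms]] by (simp add: complex_eq_iff)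

text \<open>For \<open>x \<noteq> 0\<close> the moment problem on \<open>[0, 1]\<close> is solved for \<open>(A + K)/(2K)\<close> and the unit
  vector \<open>x/|x|\<close>. The solution is transported back to \<open>[-K, K]\<close> and given the total mass
  \<open>|x|\<^sup>2\<close>.\<close>

lemma moment_measure_exists:
  fixes A :: "'a::complex_inner bop"
  assumes A: "self_adjoint A" and K: "K > 0" "\<And>x. norm (A *\<^sub>V x) \<le> K * norm x"
  obtains \<mu> where "borel_measure_on K \<mu>"
    "\<And>p. cinner (poly_op A p *\<^sub>V x) x = complex_of_real (\<integral>s. poly p s \<partial>\<mu>)"
proof (cases "x = 0")
  case True
  show thesis
  proof
    show "borel_measure_on K (null_measure borel)"
      by (auto simp: borel_measure_on_def eventually_ae_filter intro!: finite_measureI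
          bexI[of _ UNIV])
    show "cinner (poly_op A p *\<^sub>V x) x = complex_of_real (\<integral>s. poly p s \<partial>null_measure borel)" for p
      using True by simp
  qed
next
  case False
  define c where "c = (norm x)\<^sup>2"
  have c: "c > 0" using False by (simp add: c_def)
  \<comment> \<open>The affine change of variable that carries \<open>[-K, K]\<close> to \<open>[0, 1]\<close>, and its inverse.\<close>
  define u where "u = [:1 / 2, 1 / (2 * K):]"
  define v where "v = [:- K, 2 * K:]"
  define S where "S = poly_op A u"
  have S: "self_adjoint S"
    unfolding S_def by (rule self_adjoint_poly_op[OF A])
  have AS: "A = poly_op S v"
  proof -
    have "pcompose v u = [:0, 1:]"
      using K(1) by (simp add: u_def v_def pcompose_pCons)
    then show ?thesis
      unfolding S_def by (metis poly_op_pcompose poly_op_X)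
  qed
  have form: "Re (cinner (S *\<^sub>V y) y) = (norm y)\<^sup>2 / 2 + Re (cinner (A *\<^sub>V y) y) / (2 * K)" for y
    by (simp add: S_def u_def bop_plus bop_times bop_scaleC bop_scaleC_right scaleC_of_real
        cinner_add_left cinner_scaleR_left Re_cinner_self bop_scaleR_right del: of_real_divide)
  have "\<bar>Re (cinner (A *\<^sub>V y) y)\<bar> \<le> K * (norm y)\<^sup>2" for y
  proof -
    have "\<bar>Re (cinner (A *\<^sub>V y) y)\<bar> \<le> norm (A *\<^sub>V y) * norm y"
      by (rule abs_Re_cinner_le)
    also have "\<dots> \<le> (K * norm y) * norm y"
      using K(2) by (intro mult_right_mono) auto
    finally show ?thesis by (simp add: power2_eq_square mult.assoc)
  qed
  then have bounds: "- (K * (norm y)\<^sup>2) \<le> Re (cinner (A *\<^sub>V y) y)"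
      "Re (cinner (A *\<^sub>V y) y) \<le> K * (norm y)\<^sup>2" for y
    by (simp_all add: abs_le_iff minus_le_iff)
  have "0 \<le> Re (cinner (S *\<^sub>V y) y)" "Re (cinner (S *\<^sub>V y) y) \<le> (norm y)\<^sup>2" for y
    unfolding form using bounds[of y] K(1) by (simp_all add: field_simps)
  note pos = bernstein_positive[OF S this]
  define L where "L p = Re (cinner (poly_op S p *\<^sub>V x) x) / c" for p
  have "L (p + q) = L p + L q" for p q
    by (simp add: L_def poly_op_add bop_plus cinner_add_left add_divide_distrib)
  moreover have "L (smult r p) = r * L p" for r p
    by (simp add: L_def poly_op_smult bop_scaleC cinner_scaleC_left)
  moreover have "0 \<le> L ([:0, 1:] ^ i * [:1, -1:] ^ j)" for i j
    unfolding L_def using pos c by (intro divide_nonneg_pos)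
  moreover have "L 1 = 1"
    using c by (simp add: L_def Re_cinner_self c_def)
  ultimately obtain M where M: "real_distribution M" "AE s in M. 0 \<le> s \<and> s \<le> 1"
      and LM: "\<And>p. L p = (\<integral>s. poly p s \<partial>M)"
    using hausdorff_moment_problem[of L] by blast
  interpret real_distribution M by (rule M)
  define M' where "M' = distr M borel (poly v)"
  have v_meas: "poly v \<in> borel_measurable M"
    unfolding measurable_cong_sets[OF events_eq_borel refl]
    by (intro borel_measurable_continuous_onI continuous_intros)
  interpret M': prob_space M'
    unfolding M'_def using v_meas by (rule prob_space_distr)
  have supp: "AE s in M'. \<bar>s\<bar> \<le> K"
    unfolding M'_def
  proof (subst AE_distr_iff[OF v_meas])
    show "AE s in M. \<bar>poly v s\<bar> \<le> K"
      using M(2)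
    proof eventually_elim
      case (elim s)
      then have "K * s \<le> K * 1" "0 \<le> K * s"
        using K(1) by (auto intro!: mult_left_mono)
      then show ?case
        by (simp add: v_def abs_le_iff algebra_simps)
    qed
  qed simp
  define \<mu> where "\<mu> = density M' (\<lambda>_. ennreal c)"
  have sets_M': "sets M' = sets borel"
    by (simp add: M'_def)
  have M'_on: "borel_measure_on K M'"
    using supp sets_M' M'.finite_measure_axioms by (simp add: borel_measure_on_def)
  show thesis
  proof
    have "emeasure \<mu> (space \<mu>) = ennreal c * emeasure M' (space M')"
      unfolding \<mu>_def by (simp add: emeasure_density nn_integral_cmult)
    then have "finite_measure \<mu>"
      by (intro finite_measureI) (simp add: M'.emeasure_space_1)
    moreover have "AE s in \<mu>. \<bar>s\<bar> \<le> K"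
      unfolding \<mu>_def using supp by (subst AE_density) auto
    moreover have "sets \<mu> = sets borel"
      by (simp add: \<mu>_def sets_M')
    ultimately show "borel_measure_on K \<mu>"
      by (simp add: borel_measure_on_def)
    fix p :: "real poly"
    have poly_meas: "poly p \<in> borel_measurable borel"
      by (intro borel_measurable_continuous_onI continuous_intros)
    have "(\<integral>s. poly p s \<partial>\<mu>) = (\<integral>s. c *\<^sub>R poly p s \<partial>M')"
      unfolding \<mu>_def using c borel_measurable_on[OF M'_on poly_meas]
      by (intro integral_density) auto
    also have "\<dots> = c * (\<integral>s. poly p (poly v s) \<partial>M)"
      unfolding M'_def using v_meas poly_meas by (simp add: integral_distr)
    also have "(\<integral>s. poly p (poly v s) \<partial>M) = L (pcompose p v)"
      by (simp add: LM poly_pcompose)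
    also have "c * L (pcompose p v) = Re (cinner (poly_op A p *\<^sub>V x) x)"
      using c AS by (simp add: L_def poly_op_pcompose)
    finally show "cinner (poly_op A p *\<^sub>V x) x = complex_of_real (\<integral>s. poly p s \<partial>\<mu>)"
      using cinner_poly_op_real[OF A] by simp
  qed
qed

lemma norm_poly_op_integral:
  assumes A: "self_adjoint A"
    and moments: "\<And>p. cinner (poly_op A p *\<^sub>V x) x = complex_of_real (\<integral>s. poly p s \<partial>\<mu>)"
  shows "(norm (poly_op A p *\<^sub>V x))\<^sup>2 = (\<integral>s. (poly p s)\<^sup>2 \<partial>\<mu>)"
proof -
  have "(norm (poly_op A p *\<^sub>V x))\<^sup>2 = Re (cinner (poly_op A (p * p) *\<^sub>V x) x)"
    by (simp add: cinner_poly_op_mult[OF A] Re_cinner_self)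
  then show ?thesis
    by (simp add: moments power2_eq_square)
qed

text \<open>For \<open>t\<close> outside the spectrum, \<open>|(A - t)p(A)x|\<^sup>2 \<ge> \<delta>\<^sup>2|p(A)x|\<^sup>2\<close> says that
  \<open>(s - t)\<^sup>2 - \<delta>\<^sup>2\<close> has nonnegative integral against every \<open>p\<^sup>2\<close>, so that the
  measure does not charge the ball of radius \<open>\<delta>\<close> around \<open>t\<close>.\<close>

lemma AE_in_real_spectrum:
  fixes A :: "'a::complex_hilbert bop"
  assumes A: "self_adjoint A" and \<mu>: "borel_measure_on K \<mu>"
    and moments: "\<And>p. cinner (poly_op A p *\<^sub>V x) x = complex_of_real (\<integral>s. poly p s \<partial>\<mu>)"
  shows "AE s in \<mu>. s \<in> real_spectrum A"
proof -
  define \<U> where "\<U> = {ball t \<delta> | t \<delta>. t \<notin> real_spectrum A \<and> \<delta> > 0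
    \<and> (\<forall>x. \<delta> * norm x \<le> norm (A *\<^sub>V x - t *\<^sub>R x))}"
  have null: "AE s in \<mu>. s \<notin> U" if "U \<in> \<U>" for U
  proof -
    from that obtain t \<delta> where U: "U = ball t \<delta>" and "\<delta> > 0"
        and below: "\<And>x. \<delta> * norm x \<le> norm (A *\<^sub>V x - t *\<^sub>R x)"
      by (auto simp: \<U>_def)
    let ?w = "\<lambda>s. (s - t)\<^sup>2 - \<delta>\<^sup>2"
    have w: "locally_bounded_borel ?w"
      by (intro lbb)
    have "0 \<le> (\<integral>s. (poly p s)\<^sup>2 * ?w s \<partial>\<mu>)" for p
    proof -
      let ?q = "[:- t, 1:] * p"
      have "poly_op A ?q *\<^sub>V x = A *\<^sub>V (poly_op A p *\<^sub>V x) - t *\<^sub>R (poly_op A p *\<^sub>V x)"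
        unfolding poly_op_mult bop_times
        by (simp add: bop_simps scaleC_one bop_scaleC_right scaleC_of_real
            scaleC_of_real[of "- _", simplified])
      then have "\<delta> * norm (poly_op A p *\<^sub>V x) \<le> norm (poly_op A ?q *\<^sub>V x)"
        using below[of "poly_op A p *\<^sub>V x"] by simp
      then have "(\<delta> * norm (poly_op A p *\<^sub>V x))\<^sup>2 \<le> (norm (poly_op A ?q *\<^sub>V x))\<^sup>2"
        using \<open>\<delta> > 0\<close> by (intro power_mono) auto
      then have "\<delta>\<^sup>2 * (\<integral>s. (poly p s)\<^sup>2 \<partial>\<mu>) \<le> (\<integral>s. (poly ?q s)\<^sup>2 \<partial>\<mu>)"
        by (simp only: power_mult_distrib norm_poly_op_integral[OF A moments])
      moreover have "(\<integral>s. (poly p s)\<^sup>2 * ?w s \<partial>\<mu>)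
          = (\<integral>s. (poly ?q s)\<^sup>2 - \<delta>\<^sup>2 * (poly p s)\<^sup>2 \<partial>\<mu>)"
        by (intro Bochner_Integration.integral_cong refl)
          (simp add: power2_eq_square algebra_simps)
      moreover have "\<dots> = (\<integral>s. (poly ?q s)\<^sup>2 \<partial>\<mu>) - \<delta>\<^sup>2 * (\<integral>s. (poly p s)\<^sup>2 \<partial>\<mu>)"
      proof -
        have "integrable \<mu> (\<lambda>s. (poly ?q s)\<^sup>2)" "integrable \<mu> (\<lambda>s. (poly p s)\<^sup>2)"
          by (intro integrable_lbb[OF \<mu>] lbb)+
        then show ?thesis
          by (subst Bochner_Integration.integral_diff) auto
      qed
      ultimately show ?thesis
        by linarith
    qed
    then have "AE s in \<mu>. 0 \<le> ?w s"
      by (rule AE_nonneg_if_square_integrals_nonneg[OF \<mu> w])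
    then show ?thesis
    proof eventually_elim
      case (elim s)
      then have "\<bar>\<delta>\<bar> \<le> \<bar>s - t\<bar>"
        by (simp add: abs_le_square_iff)
      then show ?case
        using \<open>\<delta> > 0\<close> by (simp add: U dist_real_def)
    qed
  qed
  obtain \<U>' where \<U>': "\<U>' \<subseteq> \<U>" "countable \<U>'" "\<Union>\<U>' = \<Union>\<U>"
    using Lindelof[of \<U>] by (auto simp: \<U>_def)
  have "AE s in \<mu>. \<forall>U\<in>\<U>'. s \<notin> U"
    using null \<U>' by (subst AE_ball_countable) auto
  then show ?thesis
  proof eventually_elim
    case (elim s)
    then have "s \<notin> \<Union>\<U>"
      using \<U>'(3) by auto
    then show ?case
      using not_in_real_spectrum_iff[OF A, of s] by (force simp: \<U>_def)
  qed
qed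

lemma norm_bound_supports:
  fixes A :: "'a::complex_hilbert bop"
  assumes "self_adjoint A" "\<And>x. norm (A *\<^sub>V x) \<le> K * norm x"
    and "sets \<mu> = sets borel" "finite_measure \<mu>" "AE s in \<mu>. complex_of_real s \<in> spectrum A"
  shows "borel_measure_on K \<mu>"
proof -
  have "AE s in \<mu>. \<bar>s\<bar> \<le> K"
    using assms(5) by eventually_elim
      (auto intro!: real_spectrum_bounded[OF assms(1,2)] simp: real_spectrum_def)
  with assms show ?thesis
    by (simp add: borel_measure_on_def)
qed

lemma poly_op_eq_power: "poly_op A ([:0, 1:] ^ n) = A ^ n"
  by (simp only: poly_op_power poly_op_X)

text \<open>The description that defines \<open>spectral_measure_at\<close> is satisfied by the solution of the moment
  problem, and by nothing else, because the spectrum is bounded and moments determine a measure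
  with compact support.\<close>

theorem spectral_measure_at:
  fixes A :: "'a::complex_hilbert bop"
  assumes A: "self_adjoint A" and K: "K > 0" "\<And>x. norm (A *\<^sub>V x) \<le> K * norm x"
  shows "borel_measure_on K (spectral_measure_at A x)"
    and "AE s in spectral_measure_at A x. s \<in> real_spectrum A"
    and "cinner (poly_op A p *\<^sub>V x) x = complex_of_real (\<integral>s. poly p s \<partial>spectral_measure_at A x)"
proof -
  obtain \<mu> where \<mu>: "borel_measure_on K \<mu>"
      and moments: "\<And>p. cinner (poly_op A p *\<^sub>V x) x = complex_of_real (\<integral>s. poly p s \<partial>\<mu>)"
    using moment_measure_exists[OF A K] by blast
  have spec: "AE s in \<mu>. s \<in> real_spectrum A"
    by (rule AE_in_real_spectrum[OF A \<mu> moments])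
  have powers: "cinner (A ^ n *\<^sub>V x) x = complex_of_real (\<integral>s. s ^ n \<partial>\<mu>)" for n
    using moments[of "[:0, 1:] ^ n"] by (simp add: poly_op_eq_power)
  have eq: "spectral_measure_at A x = \<mu>"
    unfolding spectral_measure_at_def
  proof (rule the_equality)
    show "sets \<mu> = sets borel \<and> finite_measure \<mu> \<and> (AE s in \<mu>. complex_of_real s \<in> spectrum A)
      \<and> (\<forall>n. cinner (A ^ n *\<^sub>V x) x = complex_of_real (\<integral>s. s ^ n \<partial>\<mu>))"
      using \<mu> spec powers by (simp add: borel_measure_on_def real_spectrum_def)
    fix \<nu> :: "real measure"
    assume \<nu>: "sets \<nu> = sets borel \<and> finite_measure \<nu> \<and> (AE s in \<nu>. complex_of_real s \<in> spectrum A)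
      \<and> (\<forall>n. cinner (A ^ n *\<^sub>V x) x = complex_of_real (\<integral>s. s ^ n \<partial>\<nu>))"
    then have "borel_measure_on K \<nu>"
      using norm_bound_supports[OF A K(2)] by blast
    moreover have "(\<integral>s. s ^ n \<partial>\<nu>) = (\<integral>s. s ^ n \<partial>\<mu>)" for n
      using \<nu> powers[of n] by (metis of_real_eq_iff)
    ultimately show "\<nu> = \<mu>"
      using \<mu> by (intro measure_eqI_moments)
  qed
  show "borel_measure_on K (spectral_measure_at A x)"
    "AE s in spectral_measure_at A x. s \<in> real_spectrum A"
    "cinner (poly_op A p *\<^sub>V x) x = complex_of_real (\<integral>s. poly p s \<partial>spectral_measure_at A x)"
    unfolding eq by (fact \<mu> spec moments)+
qed

section \<open>The bounded Borel calculus\<close>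

context
  fixes A :: "'a::complex_hilbert bop" and K B :: real and h :: "real \<Rightarrow> real"
  assumes A: "self_adjoint A" and K: "K > 0" "\<And>x. norm (A *\<^sub>V x) \<le> K * norm x"
    and h: "h \<in> borel_measurable borel" "\<And>s. \<bar>h s\<bar> \<le> B"
begin

lemmas \<mu>_on = spectral_measure_at(1)[OF A K]
lemmas \<mu>_poly = spectral_measure_at(3)[OF A K]

lemma lbb_h: "locally_bounded_borel h"
  using h by (rule lbb_bounded)

lemma calculus_polynomial_approximation:
  assumes "finite X" "\<epsilon> > 0"
  obtains p where "\<And>x. x \<in> X \<Longrightarrow> (\<integral>s. (h s - poly p s)\<^sup>2 \<partial>spectral_measure_at A x) < \<epsilon>"
proof -
  have "approximable (spectral_measure_at A ` X) h"
    using assms(1) \<mu>_on by (intro polynomials_dense[OF _ _ h]) auto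
  then obtain p where "\<forall>M\<in>spectral_measure_at A ` X. (\<integral>s. (h s - poly p s)\<^sup>2 \<partial>M) < \<epsilon>"
    using assms(2) unfolding approximable_def by blast
  then show thesis
    by (intro that) blast
qed

text \<open>As \<open>|p(A)x|\<^sup>2\<close> is the integral of \<open>p\<^sup>2\<close>, polynomials that are close to \<open>h\<close> in
  \<open>L\<^sup>2(\<mu>\<^sub>x)\<close> have nearby values at \<open>x\<close>.\<close>

lemma norm_poly_op_diff_le:
  "(norm (poly_op A p *\<^sub>V x - poly_op A q *\<^sub>V x))\<^sup>2
    \<le> 2 * (\<integral>s. (h s - poly p s)\<^sup>2 \<partial>spectral_measure_at A x)
      + 2 * (\<integral>s. (h s - poly q s)\<^sup>2 \<partial>spectral_measure_at A x)"
proof -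
  let ?M = "spectral_measure_at A x"
  have "(norm (poly_op A p *\<^sub>V x - poly_op A q *\<^sub>V x))\<^sup>2 = (norm (poly_op A (p - q) *\<^sub>V x))\<^sup>2"
    by (simp add: poly_op_minus bop_minus)
  also have "\<dots> = (\<integral>s. (poly (p - q) s)\<^sup>2 \<partial>?M)"
    by (rule norm_poly_op_integral[OF A \<mu>_poly])
  also have "\<dots> = (\<integral>s. ((poly p s - h s) + (h s - poly q s))\<^sup>2 \<partial>?M)"
    by simp
  also have "\<dots> \<le> 2 * (\<integral>s. (poly p s - h s)\<^sup>2 \<partial>?M) + 2 * (\<integral>s. (h s - poly q s)\<^sup>2 \<partial>?M)"
    by (intro integral_square_triangle[of "{?M}" K] lbb lbb_h) (auto intro: \<mu>_on)
  finally show ?thesis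
    by (simp add: power2_commute)
qed

text \<open>The value \<open>h(A)x\<close> is the limit of \<open>p\<^sub>k(A)x\<close> for any polynomials \<open>p\<^sub>k \<longlonglongrightarrow> h\<close> in
  \<open>L\<^sup>2(\<mu>\<^sub>x)\<close>.  The estimate characterizes it without reference to a sequence; its factor \<open>2\<close> comes from
  \<open>(a + b)\<^sup>2 \<le> 2a\<^sup>2 + 2b\<^sup>2\<close>.\<close>

lemma calculus_vector_exists:
  "\<exists>v. \<forall>p. (norm (v - poly_op A p *\<^sub>V x))\<^sup>2
      \<le> 2 * (\<integral>s. (h s - poly p s)\<^sup>2 \<partial>spectral_measure_at A x)"
proof -
  let ?E = "\<lambda>p. \<integral>s. (h s - poly p s)\<^sup>2 \<partial>spectral_measure_at A x"
  have "\<exists>p. ?E p < 1 / real (Suc k)" for k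
    using calculus_polynomial_approximation[of "{x}" "1 / real (Suc k)"] by auto
  then obtain p where p: "\<And>k. ?E (p k) < 1 / real (Suc k)"
    by metis
  define v where "v k = poly_op A (p k) *\<^sub>V x" for k
  have inv0: "(\<lambda>k. 1 / real (Suc k)) \<longlonglongrightarrow> 0"
    using LIMSEQ_inverse_real_of_nat by (simp add: inverse_eq_divide)
  have "Cauchy v"
  proof (rule metric_CauchyI)
    fix e :: real assume "e > 0"
    then have "\<forall>\<^sub>F k in sequentially. 1 / real (Suc k) < e\<^sup>2 / 4"
      by (intro order_tendstoD(2)[OF inv0]) auto
    then obtain k0 where k0: "\<And>k. k \<ge> k0 \<Longrightarrow> 1 / real (Suc k) < e\<^sup>2 / 4"
      by (auto simp: eventually_sequentially)
    show "\<exists>M. \<forall>m\<ge>M. \<forall>n\<ge>M. dist (v m) (v n) < e"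
    proof (intro exI allI impI)
      fix m n assume "m \<ge> k0" "n \<ge> k0"
      then have "?E (p m) < e\<^sup>2 / 4" "?E (p n) < e\<^sup>2 / 4"
        using p[of m] p[of n] k0[of m] k0[of n] by linarith+
      then have "(dist (v m) (v n))\<^sup>2 < e\<^sup>2"
        using norm_poly_op_diff_le[of "p m" x "p n"] unfolding v_def dist_norm by linarith
      then show "dist (v m) (v n) < e"
        by (rule power2_less_imp_less) (use \<open>e > 0\<close> in simp)
    qed
  qed
  then obtain w where w: "v \<longlonglongrightarrow> w"
    using Cauchy_convergent convergent_def by blast
  have "(norm (w - poly_op A q *\<^sub>V x))\<^sup>2 \<le> 2 * ?E q" for q
  proof (rule LIMSEQ_le)
    show "(\<lambda>k. (norm (v k - poly_op A q *\<^sub>V x))\<^sup>2) \<longlonglongrightarrow> (norm (w - poly_op A q *\<^sub>V x))\<^sup>2"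
      by (intro tendsto_intros w)
    have "(\<lambda>k. 2 * (1 / real (Suc k)) + 2 * ?E q) \<longlonglongrightarrow> 2 * 0 + 2 * ?E q"
      by (intro tendsto_intros inv0)
    then show "(\<lambda>k. 2 * (1 / real (Suc k)) + 2 * ?E q) \<longlonglongrightarrow> 2 * ?E q"
      by simp
    have "(norm (v k - poly_op A q *\<^sub>V x))\<^sup>2 \<le> 2 * (1 / real (Suc k)) + 2 * ?E q" for k
      using norm_poly_op_diff_le[of "p k" x q] p[of k] unfolding v_def by linarith
    then show "\<exists>N. \<forall>n\<ge>N. (norm (v n - poly_op A q *\<^sub>V x))\<^sup>2 \<le> 2 * (1 / real (Suc n)) + 2 * ?E q"
      by blast
  qed
  then show ?thesis by blast
qed

text \<open>The factor \<open>q\<close> is carried along so that \<open>q = 1\<close> gives the form of \<open>h(A)\<close> and \<open>q(s) = s\<close>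
  the form of the product \<open>h(A)A\<close>, which occurs in \<open>\<zeta>\<close>.\<close>

lemma calculus_operator_exists:
  "\<exists>T. \<forall>x q. cinner (T *\<^sub>V poly_op A q *\<^sub>V x) x
    = complex_of_real (\<integral>s. h s * poly q s \<partial>spectral_measure_at A x)"
proof -
  let ?E = "\<lambda>p x. \<integral>s. (h s - poly p s)\<^sup>2 \<partial>spectral_measure_at A x"
  obtain F where F: "\<And>x p. (norm (F x - poly_op A p *\<^sub>V x))\<^sup>2 \<le> 2 * ?E p x"
    using calculus_vector_exists by metis
  \<comment> \<open>A common approximating polynomial for finitely many vectors makes \<open>F\<close> inherit
    every linear relation from the operators \<open>p(A)\<close>.\<close>
  have approx: "\<exists>p. \<forall>x\<in>X. norm (F x - poly_op A p *\<^sub>V x) \<le> \<epsilon> \<and> ?E p x < \<epsilon>\<^sup>2"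
    if fin: "finite X" and e: "\<epsilon> > 0" for X \<epsilon>
  proof -
    obtain p where p: "\<And>x. x \<in> X \<Longrightarrow> ?E p x < \<epsilon>\<^sup>2 / 2"
      using calculus_polynomial_approximation[OF fin, of "\<epsilon>\<^sup>2 / 2"] e by auto
    have "norm (F x - poly_op A p *\<^sub>V x) \<le> \<epsilon> \<and> ?E p x < \<epsilon>\<^sup>2" if x: "x \<in> X" for x
    proof
      have pos: "0 < \<epsilon>\<^sup>2" using \<open>\<epsilon> > 0\<close> by simp
      show "?E p x < \<epsilon>\<^sup>2"
        using p[OF x] pos by linarith
      have "(norm (F x - poly_op A p *\<^sub>V x))\<^sup>2 \<le> \<epsilon>\<^sup>2"
        using F[of x p] p[OF x] by linarith
      then show "norm (F x - poly_op A p *\<^sub>V x) \<le> \<epsilon>"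
        by (rule power2_le_imp_le) (use e in simp)
    qed
    then show ?thesis by blast
  qed
  have "F (x + y) = F x + F y" for x y
  proof -
    have "norm (F (x + y) - (F x + F y)) \<le> 0 + e" if e0: "e > 0" for e
    proof -
      obtain p where p: "\<forall>z\<in>{x + y, x, y}. norm (F z - poly_op A p *\<^sub>V z) \<le> e / 3 \<and> ?E p z < (e / 3)\<^sup>2"
        using approx[of "{x + y, x, y}" "e / 3", OF _ divide_pos_pos[OF e0]] by force
      let ?d = "\<lambda>z. F z - poly_op A p *\<^sub>V z"
      have "F (x + y) - (F x + F y) = ?d (x + y) - ?d x - ?d y"
        by (simp add: bop_add_right)
      also have "norm \<dots> \<le> norm (?d (x + y)) + norm (?d x) + norm (?d y)"
        by (meson add_mono norm_triangle_ineq4 order_refl order_trans)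
      also have "\<dots> \<le> e / 3 + e / 3 + e / 3"
        using p by (intro add_mono) auto
      finally show ?thesis by simp
    qed
    then have "norm (F (x + y) - (F x + F y)) \<le> 0"
      by (rule field_le_epsilon)
    then show ?thesis by simp
  qed
  moreover have "F (c *\<^sub>C x) = c *\<^sub>C F x" for c x
  proof -
    have "norm (F (c *\<^sub>C x) - c *\<^sub>C F x) \<le> 0 + e" if e0: "e > 0" for e
    proof -
      define e' where "e' = e / (1 + cmod c)"
      have c: "1 + cmod c > 0" by (simp add: add_pos_nonneg)
      then have e': "e' > 0" using e0 by (simp add: e'_def)
      obtain p where p: "\<forall>z\<in>{c *\<^sub>C x, x}. norm (F z - poly_op A p *\<^sub>V z) \<le> e' \<and> ?E p z < e'\<^sup>2"
        using approx[of "{c *\<^sub>C x, x}" e', OF _ e'] by force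
      let ?d = "\<lambda>z. F z - poly_op A p *\<^sub>V z"
      have "c *\<^sub>C ?d x = c *\<^sub>C F x - c *\<^sub>C (poly_op A p *\<^sub>V x)"
        using scaleC_add_right[of c "?d x" "poly_op A p *\<^sub>V x"] by (simp add: algebra_simps)
      then have "F (c *\<^sub>C x) - c *\<^sub>C F x = ?d (c *\<^sub>C x) - c *\<^sub>C ?d x"
        by (simp add: bop_scaleC_right)
      also have "norm \<dots> \<le> norm (?d (c *\<^sub>C x)) + cmod c * norm (?d x)"
        using norm_triangle_ineq4[of "?d (c *\<^sub>C x)" "c *\<^sub>C ?d x"] by (simp add: norm_scaleC)
      also have "\<dots> \<le> e' + cmod c * e'"
        using p by (intro add_mono mult_left_mono) auto
      also have "\<dots> = e' * (1 + cmod c)"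
        by (simp add: algebra_simps)
      also have "\<dots> = e"
        using c by (simp add: e'_def)
      finally show ?thesis by simp
    qed
    then have "norm (F (c *\<^sub>C x) - c *\<^sub>C F x) \<le> 0"
      by (rule field_le_epsilon)
    then show ?thesis by simp
  qed
  moreover have "norm (F x) \<le> 2 * \<bar>B\<bar> * norm x" for x
  proof -
    let ?M = "spectral_measure_at A x"
    have "(norm (F x))\<^sup>2 \<le> 2 * (\<integral>s. (h s)\<^sup>2 \<partial>?M)"
      using F[of x 0] by simp
    moreover have "(\<integral>s. (h s)\<^sup>2 \<partial>?M) \<le> (\<integral>s. B\<^sup>2 * (poly 1 s)\<^sup>2 \<partial>?M)"
    proof (intro integral_mono_lbb[OF \<mu>_on] lbb lbb_h AE_I2)
      fix s
      have "\<bar>h s\<bar> \<le> \<bar>B\<bar>"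
        using h(2)[of s] by linarith
      then show "(h s)\<^sup>2 \<le> B\<^sup>2 * (poly 1 s)\<^sup>2"
        by (simp add: abs_le_square_iff)
    qed
    moreover have "(\<integral>s. B\<^sup>2 * (poly 1 s)\<^sup>2 \<partial>?M) = B\<^sup>2 * (norm x)\<^sup>2"
      using norm_poly_op_integral[OF A \<mu>_poly, of 1 x] by simp
    moreover have "2 * (B\<^sup>2 * (norm x)\<^sup>2) \<le> (2 * \<bar>B\<bar> * norm x)\<^sup>2"
      by (simp add: power_mult_distrib)
    ultimately have "(norm (F x))\<^sup>2 \<le> (2 * \<bar>B\<bar> * norm x)\<^sup>2"
      by linarith
    then show ?thesis
      by (rule power2_le_imp_le) (intro mult_nonneg_nonneg; simp)
  qed
  ultimately obtain T where T: "\<And>x. T *\<^sub>V x = F x"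
    using bop_of_linear by blast
  have "cinner (T *\<^sub>V poly_op A q *\<^sub>V x) x
      = complex_of_real (\<integral>s. h s * poly q s \<partial>spectral_measure_at A x)" for q x
  proof -
    let ?M = "spectral_measure_at A x" and ?y = "poly_op A q *\<^sub>V x"
    let ?I = "\<integral>s. h s * poly q s \<partial>spectral_measure_at A x"
    define c where "c = norm x + ((\<integral>s. (poly q s)\<^sup>2 \<partial>?M) + 1)"
    have c: "c > 0"
      by (simp add: c_def add_nonneg_pos)
    have "cmod (cinner (F ?y) x - complex_of_real ?I) \<le> 0 + e" if e0: "e > 0" for e
    proof -
      define e' where "e' = e / c"
      have e': "e' > 0" using c e0 by (simp add: e'_def)
      obtain p where p: "\<forall>z\<in>{?y, x}. norm (F z - poly_op A p *\<^sub>V z) \<le> e' \<and> ?E p z < e'\<^sup>2"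
        using approx[of "{?y, x}" e', OF _ e'] by force
      have "cinner (poly_op A p *\<^sub>V ?y) x = cinner (poly_op A (p * q) *\<^sub>V x) x"
        by (simp add: poly_op_mult bop_times)
      also have "\<dots> = complex_of_real (\<integral>s. poly p s * poly q s \<partial>?M)"
        by (simp add: \<mu>_poly)
      also have "(\<integral>s. poly p s * poly q s \<partial>?M) = ?I - (\<integral>s. (h s - poly p s) * poly q s \<partial>?M)"
      proof -
        have "integrable ?M (\<lambda>s. h s * poly q s)" "integrable ?M (\<lambda>s. poly p s * poly q s)"
          by (intro integrable_lbb[OF \<mu>_on] lbb lbb_h)+
        then show ?thesis
          by (simp add: left_diff_distrib)
      qed
      finally have "cinner (F ?y) x - complex_of_real ?I = cinner (F ?y - poly_op A p *\<^sub>V ?y) x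
          - complex_of_real (\<integral>s. (h s - poly p s) * poly q s \<partial>?M)"
        by (simp add: cinner_diff_left)
      also have "cmod \<dots> \<le> cmod (cinner (F ?y - poly_op A p *\<^sub>V ?y) x)
          + \<bar>\<integral>s. (h s - poly p s) * poly q s \<partial>?M\<bar>"
        by (rule order_trans[OF norm_triangle_ineq4]) (simp only: norm_of_real order_refl)
      also have "\<dots> \<le> e' * norm x + e' * ((\<integral>s. (poly q s)\<^sup>2 \<partial>?M) + 1)"
      proof (intro add_mono)
        show "cmod (cinner (F ?y - poly_op A p *\<^sub>V ?y) x) \<le> e' * norm x"
          using p by (intro order_trans[OF cmod_cinner_le] mult_right_mono) auto
        show "\<bar>\<integral>s. (h s - poly p s) * poly q s \<partial>?M\<bar> \<le> e' * ((\<integral>s. (poly q s)\<^sup>2 \<partial>?M) + 1)"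
          using p e' by (intro integral_pairing_small[OF \<mu>_on] lbb lbb_h) auto
      qed
      also have "\<dots> = e' * c"
        by (simp add: c_def algebra_simps)
      also have "\<dots> = e"
        using c by (simp add: e'_def)
      finally show ?thesis by simp
    qed
    then have "cmod (cinner (F ?y) x - complex_of_real ?I) \<le> 0"
      by (rule field_le_epsilon)
    then show ?thesis
      by (simp add: T)
  qed
  then show ?thesis by blast
qed

end

text \<open>Functions for which \<open>borel_calculus\<close> is meaningful. Only values on the spectrum matter, so
  the conditions are put on the extension by zero.\<close>

definition calculus_admissible :: "'a::complex_hilbert bop \<Rightarrow> (real \<Rightarrow> real) \<Rightarrow> bool" where
  "calculus_admissible A g \<longleftrightarrow>
     (\<lambda>s. indicator (real_spectrum A) s * g s) \<in> borel_measurable borel \<and>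
     (\<exists>B. \<forall>s\<in>real_spectrum A. \<bar>g s\<bar> \<le> B)"

lemma calculus_admissible_lbb:
  assumes "calculus_admissible A g"
  shows "locally_bounded_borel (\<lambda>s. indicator (real_spectrum A) s * g s)"
proof -
  obtain B where "\<forall>s\<in>real_spectrum A. \<bar>g s\<bar> \<le> B"
    using assms by (auto simp: calculus_admissible_def)
  then have "\<bar>indicator (real_spectrum A) s * g s\<bar> \<le> \<bar>B\<bar>" for s
    by (auto simp: indicator_def intro: order_trans)
  with assms show ?thesis
    by (auto simp: calculus_admissible_def intro: lbb_bounded)
qed

theorem borel_calculus_form:
  fixes A :: "'a::complex_hilbert bop"
  assumes A: "self_adjoint A" and g: "calculus_admissible A g"
  shows "cinner (borel_calculus g A *\<^sub>V x) x = complex_of_real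
      (\<integral>s. indicator (real_spectrum A) s * g s \<partial>spectral_measure_at A x)"
    and "cinner ((borel_calculus g A * A) *\<^sub>V x) x = complex_of_real
      (\<integral>s. indicator (real_spectrum A) s * g s * s \<partial>spectral_measure_at A x)"
proof -
  let ?h = "\<lambda>s. indicator (real_spectrum A) s * g s"
  obtain K where K: "K > 0" "\<And>x. norm (A *\<^sub>V x) \<le> K * norm x"
    using bop_bounded by blast
  obtain B where "\<forall>s\<in>real_spectrum A. \<bar>g s\<bar> \<le> B"
    using g by (auto simp: calculus_admissible_def)
  then have "\<bar>?h s\<bar> \<le> \<bar>B\<bar>" for s
    by (auto simp: indicator_def intro: order_trans)
  then obtain T where T: "\<And>x q. cinner (T *\<^sub>V poly_op A q *\<^sub>V x) x
      = complex_of_real (\<integral>s. ?h s * poly q s \<partial>spectral_measure_at A x)"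
    using calculus_operator_exists[OF A K, of ?h "\<bar>B\<bar>"] g
    by (auto simp: calculus_admissible_def)
  have form: "cinner (T *\<^sub>V x) x = complex_of_real (\<integral>s. ?h s \<partial>spectral_measure_at A x)" for x
    using T[of 1 x] by simp
  have "borel_calculus g A = T"
    unfolding borel_calculus_def
  proof (rule the_equality)
    show "\<forall>x. cinner (T *\<^sub>V x) x = complex_of_real
       (\<integral>s\<in>{s. complex_of_real s \<in> spectrum A}. g s \<partial>spectral_measure_at A x)"
      by (simp add: form set_lebesgue_integral_def real_spectrum_def)
    fix T' assume "\<forall>x. cinner (T' *\<^sub>V x) x = complex_of_real
       (\<integral>s\<in>{s. complex_of_real s \<in> spectrum A}. g s \<partial>spectral_measure_at A x)"
    then show "T' = T"
      by (intro bop_eqI_quadratic) (simp add: form set_lebesgue_integral_def real_spectrum_def)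
  qed
  then show "cinner (borel_calculus g A *\<^sub>V x) x = complex_of_real
      (\<integral>s. ?h s \<partial>spectral_measure_at A x)"
    "cinner ((borel_calculus g A * A) *\<^sub>V x) x = complex_of_real
      (\<integral>s. ?h s * s \<partial>spectral_measure_at A x)"
    using T[of "[:0, 1:]" x] by (simp_all add: form bop_times scaleC_one)
qed

lemma self_adjoint_borel_calculus:
  "self_adjoint A \<Longrightarrow> calculus_admissible A g \<Longrightarrow> self_adjoint (borel_calculus g A)"
  by (rule self_adjointI_real) (simp add: borel_calculus_form(1))

text \<open>On the compact spectrum a nondecreasing function lies between its values at the two
  endpoints.\<close>

lemma calculus_admissible_mono:
  fixes A :: "'a::complex_hilbert bop"
  assumes A: "self_adjoint A" and g: "mono_on (real_spectrum A) g"
  shows "calculus_admissible A g"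
  unfolding calculus_admissible_def
proof
  let ?\<sigma> = "real_spectrum A"
  have "?\<sigma> \<in> sets borel"
    using closed_real_spectrum[OF A] by (rule borel_closed)
  then show "(\<lambda>s. indicator ?\<sigma> s * g s) \<in> borel_measurable borel"
    using borel_measurable_mono_on_fnc[OF g]
    by (simp add: borel_measurable_restrict_space_iff)
  show "\<exists>B. \<forall>s\<in>?\<sigma>. \<bar>g s\<bar> \<le> B"
  proof (cases "?\<sigma> = {}")
    case False
    obtain a b where ab: "a \<in> ?\<sigma>" "b \<in> ?\<sigma>" "\<And>s. s \<in> ?\<sigma> \<Longrightarrow> a \<le> s \<and> s \<le> b"
      using compact_attains_inf[OF compact_real_spectrum[OF A] False]
        compact_attains_sup[OF compact_real_spectrum[OF A] False] by blast
    have "g a \<le> g s \<and> g s \<le> g b" if "s \<in> ?\<sigma>" for s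
      using g ab that by (auto simp: mono_on_def)
    then show ?thesis
      by (intro exI[of _ "\<bar>g a\<bar> + \<bar>g b\<bar>"]) fastforce
  qed simp
qed

lemma calculus_admissible_antimono:
  fixes A :: "'a::complex_hilbert bop"
  assumes A: "self_adjoint A" and g: "monotone_on (real_spectrum A) (\<le>) (\<ge>) g"
  shows "calculus_admissible A g"
proof -
  have "mono_on (real_spectrum A) (\<lambda>s. - g s)"
    using g by (auto simp: monotone_on_def)
  then have "calculus_admissible A (\<lambda>s. - g s)"
    by (rule calculus_admissible_mono[OF A])
  then show ?thesis
    by (simp add: calculus_admissible_def)
qed

section \<open>Positive linear maps\<close>

context
  fixes \<Phi> :: "'h::complex_inner bop \<Rightarrow> 'k::complex_inner bop"
  assumes \<Phi>: "positive_linear_map \<Phi>"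
begin

lemma positive_map_add: "\<Phi> (S + T) = \<Phi> S + \<Phi> T"
  using \<Phi> by (simp add: positive_linear_map_def clinear_def)

lemma positive_map_scaleC: "\<Phi> (c *\<^sub>C T) = c *\<^sub>C \<Phi> T"
  using \<Phi> by (simp add: positive_linear_map_def clinear_def)

lemma positive_map_diff: "\<Phi> (S - T) = \<Phi> S - \<Phi> T"
  using positive_map_add[of "S - T" T] by (simp add: algebra_simps)

text \<open>A self-adjoint \<open>T\<close> is the difference of the positive operators \<open>T + K\<close> and \<open>K\<close>, for a
  norm bound \<open>K\<close>.\<close>

lemma positive_map_self_adjoint:
  assumes T: "self_adjoint T"
  shows "self_adjoint (\<Phi> T)"
proof -
  obtain K where K: "K > 0" "\<And>x. norm (T *\<^sub>V x) \<le> K * norm x"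
    using bop_bounded by blast
  let ?K = "complex_of_real K *\<^sub>C (1 :: 'h bop)"
  have "positive_op (T + ?K)"
    unfolding positive_op_def
  proof (intro conjI allI)
    show "self_adjoint (T + ?K)"
      by (intro self_adjoint_plus T self_adjoint_of_real)
    fix x
    have "\<bar>Re (cinner (T *\<^sub>V x) x)\<bar> \<le> (K * norm x) * norm x"
      by (rule order_trans[OF abs_Re_cinner_le mult_right_mono[OF K(2)]]) simp
    then show "0 \<le> Re (cinner ((T + ?K) *\<^sub>V x) x)"
      by (simp add: bop_simps cinner_add_left scaleC_of_real cinner_scaleR_left Re_cinner_self
          power2_eq_square abs_le_iff)
  qed
  moreover have "positive_op ?K"
    using K(1) by (simp add: positive_op_def self_adjoint_of_real bop_simps scaleC_of_real
        cinner_scaleR_left Re_cinner_self)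
  ultimately have "self_adjoint (\<Phi> (T + ?K))" "self_adjoint (\<Phi> ?K)"
    using \<Phi> by (auto simp: positive_linear_map_def positive_op_def)
  then have "self_adjoint (\<Phi> (T + ?K) - \<Phi> ?K)"
    by (rule self_adjoint_minus)
  then show ?thesis
    by (simp add: positive_map_add)
qed

end

text \<open>The hypothesis is \<open>T\<^sub>i - (aA\<^sub>i + b) \<ge> 0\<close>. Apply \<open>\<Phi>\<^sub>i\<close> and add up; the constants add up to
  \<open>b\<close> because the family is unital.\<close>

lemma affine_bound_transfer:
  fixes \<Phi> :: "'i \<Rightarrow> 'h::complex_inner bop \<Rightarrow> 'k::complex_inner bop"
  assumes \<Phi>: "\<And>i. i \<in> I \<Longrightarrow> positive_linear_map (\<Phi> i)"
    and unital: "(\<Sum>i\<in>I. \<Phi> i 1) = 1"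
    and sa: "\<And>i. i \<in> I \<Longrightarrow> self_adjoint (A i)" "\<And>i. i \<in> I \<Longrightarrow> self_adjoint (T i)"
    and bound: "\<And>i x. i \<in> I \<Longrightarrow>
      a * Re (cinner (A i *\<^sub>V x) x) + b * (norm x)\<^sup>2 \<le> Re (cinner (T i *\<^sub>V x) x)"
  shows "a * Re (cinner ((\<Sum>i\<in>I. \<Phi> i (A i)) *\<^sub>V y) y) + b * (norm y)\<^sup>2
    \<le> Re (cinner ((\<Sum>i\<in>I. \<Phi> i (T i)) *\<^sub>V y) y)"
proof -
  let ?D = "\<lambda>i. T i - (complex_of_real a *\<^sub>C A i + complex_of_real b *\<^sub>C 1)"
  have "0 \<le> Re (cinner (\<Phi> i (?D i) *\<^sub>V y) y)" if i: "i \<in> I" for i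
  proof -
    have "positive_op (?D i)"
      unfolding positive_op_def
      using bound[OF i] sa[OF i]
      by (auto intro!: self_adjoint_minus self_adjoint_plus self_adjoint_scale_real
            self_adjoint_of_real
          simp: bop_simps cinner_diff_left cinner_add_left scaleC_of_real cinner_scaleR_left
            Re_cinner_self)
    then show ?thesis
      using \<Phi>[OF i] by (auto simp: positive_linear_map_def positive_op_def)
  qed
  moreover have "\<Phi> i (?D i) = \<Phi> i (T i)
      - (complex_of_real a *\<^sub>C \<Phi> i (A i) + complex_of_real b *\<^sub>C \<Phi> i 1)" if "i \<in> I" for i
    by (simp only: positive_map_diff[OF \<Phi>[OF that]] positive_map_add[OF \<Phi>[OF that]]
        positive_map_scaleC[OF \<Phi>[OF that]])
  ultimately have "a * Re (cinner (\<Phi> i (A i) *\<^sub>V y) y) + b * Re (cinner (\<Phi> i 1 *\<^sub>V y) y)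
      \<le> Re (cinner (\<Phi> i (T i) *\<^sub>V y) y)" if "i \<in> I" for i
    using that by (simp add: bop_simps cinner_diff_left cinner_add_left scaleC_of_real
        cinner_scaleR_left)
  then have "(\<Sum>i\<in>I. a * Re (cinner (\<Phi> i (A i) *\<^sub>V y) y) + b * Re (cinner (\<Phi> i 1 *\<^sub>V y) y))
      \<le> (\<Sum>i\<in>I. Re (cinner (\<Phi> i (T i) *\<^sub>V y) y))"
    by (rule sum_mono)
  moreover have form_sum: "(\<Sum>i\<in>I. Re (cinner (R i *\<^sub>V y) y)) = Re (cinner ((\<Sum>i\<in>I. R i) *\<^sub>V y) y)"
    for R :: "'i \<Rightarrow> 'k bop"
    by (induction I rule: infinite_finite_induct) (simp_all add: bop_plus cinner_add_left)
  moreover have "(\<Sum>i\<in>I. Re (cinner (\<Phi> i 1 *\<^sub>V y) y)) = (norm y)\<^sup>2"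
    unfolding form_sum unital by (simp add: Re_cinner_self)
  ultimately show ?thesis
    by (simp add: sum.distrib sum_distrib_left[symmetric])
qed

section \<open>The reverse Jensen inequality\<close>

text \<open>Both sides are integrals against the spectral measure at \<open>x\<close>, which is concentrated on the
  spectrum.\<close>

lemma calculus_affine_lower_bound:
  fixes A :: "'a::complex_hilbert bop"
  assumes A: "self_adjoint A" and g: "calculus_admissible A g"
    and bound: "\<And>s. s \<in> real_spectrum A \<Longrightarrow> a * s + b \<le> g s"
  shows "a * Re (cinner (A *\<^sub>V x) x) + b * (norm x)\<^sup>2 \<le> Re (cinner (borel_calculus g A *\<^sub>V x) x)"
proof -
  obtain K where K: "K > 0" "\<And>x. norm (A *\<^sub>V x) \<le> K * norm x"
    using bop_bounded by blast
  note \<mu> = spectral_measure_at[OF A K]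
  let ?M = "spectral_measure_at A x"
  have "cinner (poly_op A [:b, a:] *\<^sub>V x) x
      = complex_of_real a * cinner (A *\<^sub>V x) x + complex_of_real b * cinner x x"
    by (simp add: bop_simps bop_scaleC_right cinner_add_left cinner_scaleC_left)
  then have "a * Re (cinner (A *\<^sub>V x) x) + b * (norm x)\<^sup>2 = (\<integral>s. poly [:b, a:] s \<partial>?M)"
    using arg_cong[OF \<mu>(3)[of "[:b, a:]" x], of Re] by (simp add: Re_cinner_self)
  also have "\<dots> \<le> (\<integral>s. indicator (real_spectrum A) s * g s \<partial>?M)"
  proof (rule integral_mono_lbb[OF \<mu>(1)])
    show "AE s in ?M. poly [:b, a:] s \<le> indicator (real_spectrum A) s * g s"
      using \<mu>(2)[of x] by eventually_elim (use bound in \<open>simp add: algebra_simps\<close>)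
  qed (rule lbb_poly calculus_admissible_lbb[OF g])+
  finally show ?thesis
    by (simp add: borel_calculus_form(1)[OF A g])
qed

text \<open>The numerical range of \<open>\<Sum>\<Phi>\<^sub>i(A\<^sub>i)\<close> stays away from a point \<open>s\<close> outside \<open>J\<close>: such a
  point lies to one side of all the spectra, at a positive distance from each of them, and
  affine bounds pass through a unital family of positive maps.\<close>

lemma real_spectrum_positive_combination:
  fixes A :: "'i \<Rightarrow> 'h::complex_hilbert bop"
    and \<Phi> :: "'i \<Rightarrow> 'h bop \<Rightarrow> 'k::complex_hilbert bop"
  assumes J: "is_interval J" and I: "finite I"
    and A: "\<And>i. i \<in> I \<Longrightarrow> self_adjoint (A i)"
    and spec: "\<And>i. i \<in> I \<Longrightarrow> real_spectrum (A i) \<subseteq> J"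
    and \<Phi>: "\<And>i. i \<in> I \<Longrightarrow> positive_linear_map (\<Phi> i)"
    and unital: "(\<Sum>i\<in>I. \<Phi> i 1) = 1"
  shows "real_spectrum (\<Sum>i\<in>I. \<Phi> i (A i)) \<subseteq> J"
proof
  let ?S = "\<Sum>i\<in>I. \<Phi> i (A i)"
  have S: "self_adjoint ?S"
    by (intro self_adjoint_sum, rule positive_map_self_adjoint[OF \<Phi> A])
  fix s assume s: "s \<in> real_spectrum ?S"
  show "s \<in> J"
  proof (rule ccontr)
    assume "s \<notin> J"
    then have "(\<forall>t\<in>J. t < s) \<or> (\<forall>t\<in>J. s < t)"
      using J unfolding is_interval_1 by (metis linorder_le_cases order_le_less)
    \<comment> \<open>The sign \<open>e\<close> tells on which side of \<open>s\<close> the interval lies.\<close>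
    then obtain e :: real where e: "e = 1 \<or> e = - 1" and side: "\<And>t. t \<in> J \<Longrightarrow> e * (t - s) < 0"
      by (metis diff_gt_0_iff_gt minus_diff_eq mult_1 mult_minus1 neg_less_0_iff_less)
    have "\<exists>\<delta>>0. \<forall>t\<in>real_spectrum (A i). e * t + (\<delta> - e * s) \<le> 0" if i: "i \<in> I" for i
    proof -
      have "s \<notin> real_spectrum (A i)"
        using spec[OF i] \<open>s \<notin> J\<close> by blast
      then obtain \<delta> where "\<delta> > 0" and \<delta>: "\<And>t. t \<in> real_spectrum (A i) \<Longrightarrow> \<delta> \<le> \<bar>t - s\<bar>"
        using real_spectrum_gap[OF A[OF i]] by metis
      have "e * t + (\<delta> - e * s) \<le> 0" if t: "t \<in> real_spectrum (A i)" for t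
        using \<delta>[OF t] side[of t] spec[OF i] t e by (auto simp: abs_if split: if_splits)
      with \<open>\<delta> > 0\<close> show ?thesis by blast
    qed
    then obtain d where d: "\<And>i. i \<in> I \<Longrightarrow> d i > 0"
        "\<And>i t. i \<in> I \<Longrightarrow> t \<in> real_spectrum (A i) \<Longrightarrow> e * t + (d i - e * s) \<le> 0"
      by metis
    \<comment> \<open>The element \<open>1\<close> covers the case of empty \<open>I\<close>.\<close>
    define \<delta> where "\<delta> = Min (insert 1 (d ` I))"
    have \<delta>: "\<delta> > 0" "\<And>i. i \<in> I \<Longrightarrow> \<delta> \<le> d i"
      using I d(1) by (auto simp: \<delta>_def)
    have zero: "calculus_admissible (A i) (\<lambda>_. 0)" for i
      by (simp add: calculus_admissible_def exI[of _ 0])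
    have form: "e * Re (cinner (A i *\<^sub>V x) x) + (\<delta> - e * s) * (norm x)\<^sup>2 \<le> Re (cinner (0 *\<^sub>V x) x)"
      if i: "i \<in> I" for i x
    proof -
      have "e * t + (\<delta> - e * s) \<le> 0" if "t \<in> real_spectrum (A i)" for t
        using d(2)[OF i that] \<delta>(2)[OF i] by linarith
      then show ?thesis
        using calculus_affine_lower_bound[OF A[OF i] zero, of e "\<delta> - e * s" x]
        by (simp add: borel_calculus_form(1)[OF A[OF i] zero])
    qed
    have "\<delta> * norm y \<le> norm (?S *\<^sub>V y - s *\<^sub>R y)" for y
    proof (cases "y = 0")
      case False
      have "e * Re (cinner (?S *\<^sub>V y) y) + (\<delta> - e * s) * (norm y)\<^sup>2
          \<le> Re (cinner ((\<Sum>i\<in>I. \<Phi> i 0) *\<^sub>V y) y)"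
        by (rule affine_bound_transfer[where T = "\<lambda>_. 0" and A = A, OF \<Phi> unital])
          (use A form self_adjoint_zero in auto)
      moreover have "\<Phi> i 0 = 0" if "i \<in> I" for i
        using positive_map_diff[OF \<Phi>[OF that], of 0 0] by simp
      ultimately have "\<delta> * (norm y)\<^sup>2 \<le> - e * Re (cinner (?S *\<^sub>V y - s *\<^sub>R y) y)"
        by (simp add: cinner_diff_left cinner_scaleR_left Re_cinner_self algebra_simps)
      also have "\<dots> \<le> \<bar>Re (cinner (?S *\<^sub>V y - s *\<^sub>R y) y)\<bar>"
        using e by auto
      also have "\<dots> \<le> norm (?S *\<^sub>V y - s *\<^sub>R y) * norm y"
        by (rule abs_Re_cinner_le)
      finally have "(\<delta> * norm y) * norm y \<le> norm (?S *\<^sub>V y - s *\<^sub>R y) * norm y"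
        by (simp add: power2_eq_square)
      then show ?thesis
        by (rule mult_right_le_imp_le) (use False in simp)
    qed simp
    then show False
      using not_in_real_spectrum_iff[OF S] \<delta>(1) s by blast
  qed
qed

text \<open>Integrating the tangent inequality \<open>C\<^sub>s\<langle>Ax, x\<rangle> + (f s - C\<^sub>s s) \<le> m\<close> in \<open>s\<close> against the
  spectral measure at the unit vector \<open>x\<close>.\<close>

lemma tangent_integral_bound:
  fixes S :: "'a::complex_hilbert bop"
  assumes S: "self_adjoint S" and f: "calculus_admissible S f" and C: "calculus_admissible S C"
    and x: "norm x = 1"
    and tangent: "\<And>s. s \<in> real_spectrum S \<Longrightarrow>
      C s * Re (cinner (S *\<^sub>V x) x) + (f s - C s * s) \<le> m"
  shows "Re (cinner (borel_calculus f S *\<^sub>V x) x) \<le> m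
    + Re (cinner ((borel_calculus C S * S) *\<^sub>V x) x
        - cinner (S *\<^sub>V x) x * cinner (borel_calculus C S *\<^sub>V x) x)"
proof -
  obtain K where K: "K > 0" "\<And>x. norm (S *\<^sub>V x) \<le> K * norm x"
    using bop_bounded by blast
  note \<mu> = spectral_measure_at[OF S K]
  let ?M = "spectral_measure_at S x" and ?i = "indicator (real_spectrum S) :: real \<Rightarrow> real"
  define a where "a = Re (cinner (S *\<^sub>V x) x)"
  have lbb_f: "locally_bounded_borel (\<lambda>s. ?i s * f s)"
    and lbb_C: "locally_bounded_borel (\<lambda>s. ?i s * C s)"
    by (intro calculus_admissible_lbb f C)+
  have int: "integrable ?M (\<lambda>s. ?i s * f s)" "integrable ?M (\<lambda>s. ?i s * C s)"
    "integrable ?M (\<lambda>s. ?i s * C s * s)"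
    by (intro integrable_lbb[OF \<mu>(1)] lbb lbb_f lbb_C)+
  have "(\<integral>s. a * (?i s * C s) + (?i s * f s - ?i s * C s * s) \<partial>?M) \<le> (\<integral>s. m * poly 1 s \<partial>?M)"
  proof (rule integral_mono_lbb[OF \<mu>(1)])
    show "AE s in ?M. a * (?i s * C s) + (?i s * f s - ?i s * C s * s) \<le> m * poly 1 s"
      using \<mu>(2)[of x] by eventually_elim (use tangent in \<open>simp add: a_def mult.commute\<close>)
  qed (intro lbb lbb_f lbb_C)+
  also have "(\<integral>s. m * poly 1 s \<partial>?M) = m"
    using arg_cong[OF \<mu>(3)[of 1 x], of Re] x by (simp add: Re_cinner_self)
  finally have "a * (\<integral>s. ?i s * C s \<partial>?M) + ((\<integral>s. ?i s * f s \<partial>?M) - (\<integral>s. ?i s * C s * s \<partial>?M)) \<le> m"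
    using int by simp
  moreover have "cinner (S *\<^sub>V x) x = complex_of_real a"
    using self_adjoint_Im[OF S] by (simp add: a_def complex_eq_iff)
  ultimately show ?thesis
    by (simp add: borel_calculus_form[OF S f] borel_calculus_form[OF S C])
qed

lemma Re_quadratic_form_nonneg_of_unit:
  fixes T :: "'a::complex_inner bop"
  assumes "\<And>x. norm x = 1 \<Longrightarrow> 0 \<le> Re (cinner (T *\<^sub>V x) x)"
  shows "0 \<le> Re (cinner (T *\<^sub>V y) y)"
proof (cases "y = 0")
  case False
  let ?x = "(1 / norm y) *\<^sub>R y"
  have "norm ?x = 1"
    using False by simp
  then have "0 \<le> Re (cinner (T *\<^sub>V ?x) ?x)"
    by (rule assms)
  also have "\<dots> = Re (cinner (T *\<^sub>V y) y) / (norm y)\<^sup>2"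
    by (simp add: bop_scaleR_right cinner_scaleR_left cinner_scaleR_right power2_eq_square
        del: of_real_divide)
  finally show ?thesis
    using False by (simp add: zero_le_divide_iff)
qed simp

text \<open>The supremum of a set of reals that is not bounded above would be an unspecified value, so
  this is what makes \<open>\<zeta>\<close> an upper bound.\<close>

lemma covariance_bdd_above:
  fixes S T :: "'a::complex_inner bop"
  shows "bdd_above {Re (cinner ((T * S) *\<^sub>V x) x - cinner (S *\<^sub>V x) x * cinner (T *\<^sub>V x) x) | x.
    norm x = 1}"
proof -
  obtain K L where K: "K > 0" "\<And>x. norm (S *\<^sub>V x) \<le> K * norm x"
    and L: "L > 0" "\<And>x. norm (T *\<^sub>V x) \<le> L * norm x"
    using bop_bounded[of S] bop_bounded[of T] by metis
  have "Re (cinner ((T * S) *\<^sub>V x) x - cinner (S *\<^sub>V x) x * cinner (T *\<^sub>V x) x) \<le> L * K + K * L"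
    if x: "norm x = 1" for x
  proof -
    have S: "norm (S *\<^sub>V x) \<le> K" and T: "norm (T *\<^sub>V x) \<le> L"
      using K(2)[of x] L(2)[of x] x by auto
    have "norm (T *\<^sub>V S *\<^sub>V x) \<le> L * K"
      using L(2)[of "S *\<^sub>V x"] mult_left_mono[OF S, of L] L(1) by linarith
    then have TS: "cmod (cinner ((T * S) *\<^sub>V x) x) \<le> L * K"
      using cmod_cinner_le[of "(T * S) *\<^sub>V x" x] x by (simp add: bop_times)
    have "cmod (cinner (S *\<^sub>V x) x) \<le> K" "cmod (cinner (T *\<^sub>V x) x) \<le> L"
      using cmod_cinner_le[of "S *\<^sub>V x" x] cmod_cinner_le[of "T *\<^sub>V x" x] x S T by auto
    then have "cmod (cinner (S *\<^sub>V x) x * cinner (T *\<^sub>V x) x) \<le> K * L"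
      unfolding norm_mult using K(1) by (intro mult_mono) auto
    with TS have "cmod (cinner ((T * S) *\<^sub>V x) x - cinner (S *\<^sub>V x) x * cinner (T *\<^sub>V x) x)
        \<le> L * K + K * L"
      by (intro order_trans[OF norm_triangle_ineq4] add_mono)
    then show ?thesis
      using complex_Re_le_cmod order_trans by blast
  qed
  then show ?thesis
    by (intro bdd_aboveI[of _ "L * K + K * L"]) blast
qed

theorem theorem2p2:
  fixes J :: "real set"
    and f C :: "real \<Rightarrow> real"
    and n :: nat
    and A :: "nat \<Rightarrow> 'h::complex_hilbert bop"
    and \<Phi> :: "nat \<Rightarrow> 'h bop \<Rightarrow> 'k::complex_hilbert bop"
    and S :: "'k bop"
    and \<zeta> :: real
  assumes J: "is_interval J"
    and f_mono: "monotone_on J (\<le>) (\<le>) f \<or> monotone_on J (\<le>) (\<ge>) f"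
    and f_convex: "convex_on J f"
    and C: "\<And>s t. s \<in> J \<Longrightarrow> t \<in> J \<Longrightarrow> C s * (t - s) + f s \<le> f t"
    and A_sa: "\<And>i. i \<in> {1..n} \<Longrightarrow> self_adjoint (A i)"
    and A_spec: "\<And>i. i \<in> {1..n} \<Longrightarrow> spectrum (A i) \<subseteq> complex_of_real ` J"
    and \<Phi>: "\<And>i. i \<in> {1..n} \<Longrightarrow> positive_linear_map (\<Phi> i)"
    and \<Phi>_unital: "(\<Sum>i=1..n. \<Phi> i 1) = 1"
    and S: "S = (\<Sum>i=1..n. \<Phi> i (A i))"
    and \<zeta>: "\<zeta> = Sup {Re (cinner ((borel_calculus C S * S) *\<^sub>V x) x
                 - cinner (S *\<^sub>V x) x * cinner (borel_calculus C S *\<^sub>V x) x) | x. norm x = 1}"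
  shows "borel_calculus f S
    \<preceq> (\<Sum>i=1..n. \<Phi> i (borel_calculus f (A i))) + complex_of_real \<zeta> *\<^sub>C 1"
proof -
  have A_J: "real_spectrum (A i) \<subseteq> J" if "i \<in> {1..n}" for i
    using A_spec[OF that] by (auto simp: real_spectrum_def)
  have S_sa: "self_adjoint S"
    unfolding S by (intro self_adjoint_sum, rule positive_map_self_adjoint[OF \<Phi> A_sa])
  have S_J: "real_spectrum S \<subseteq> J"
    unfolding S by (intro real_spectrum_positive_combination J A_sa A_J \<Phi> \<Phi>_unital finite_atLeastAtMost)
  have f_admissible: "calculus_admissible T f" if "self_adjoint T" "real_spectrum T \<subseteq> J"
    for T :: "'b::complex_hilbert bop"
    using f_mono calculus_admissible_mono[OF that(1)] calculus_admissible_antimono[OF that(1)]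
      monotone_on_subset[OF _ that(2)] by blast
  \<comment> \<open>Adding the tangent inequalities at \<open>s\<close> and at \<open>t\<close> gives \<open>(C t - C s)(t - s) \<ge> 0\<close>.\<close>
  have "C s \<le> C t" if "s \<in> J" "t \<in> J" "s \<le> t" for s t
  proof (cases "s = t")
    case False
    have "C s * (t - s) \<le> C t * (t - s)"
      using C[OF that(1,2)] C[OF that(2,1)] by (simp add: algebra_simps)
    then show ?thesis
      by (rule mult_right_le_imp_le) (use False that in simp)
  qed simp
  then have "mono_on (real_spectrum S) C"
    using S_J by (auto simp: mono_on_def)
  then have C_admissible: "calculus_admissible S C"
    by (rule calculus_admissible_mono[OF S_sa])
  let ?R = "\<Sum>i=1..n. \<Phi> i (borel_calculus f (A i))"
  have f_sa: "self_adjoint (borel_calculus f (A i))" if "i \<in> {1..n}" for i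
    using that by (intro self_adjoint_borel_calculus f_admissible A_sa A_J)
  have tangent: "C s * Re (cinner (S *\<^sub>V y) y) + (f s - C s * s) * (norm y)\<^sup>2 \<le> Re (cinner (?R *\<^sub>V y) y)"
    if s: "s \<in> J" for s y
    unfolding S
  proof (rule affine_bound_transfer[OF \<Phi> \<Phi>_unital A_sa f_sa])
    fix i x assume i: "i \<in> {1..n}"
    show "C s * Re (cinner (A i *\<^sub>V x) x) + (f s - C s * s) * (norm x)\<^sup>2
        \<le> Re (cinner (borel_calculus f (A i) *\<^sub>V x) x)"
      using C[OF s] A_J[OF i]
      by (intro calculus_affine_lower_bound A_sa f_admissible A_J i) (auto simp: algebra_simps)
  qed
  have R_sa: "self_adjoint (?R + complex_of_real \<zeta> *\<^sub>C 1)"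
    by (intro self_adjoint_plus self_adjoint_sum self_adjoint_of_real,
        rule positive_map_self_adjoint[OF \<Phi> f_sa])
  have f_S_sa: "self_adjoint (borel_calculus f S)"
    by (intro self_adjoint_borel_calculus f_admissible S_sa S_J)
  have "0 \<le> Re (cinner ((?R + complex_of_real \<zeta> *\<^sub>C 1 - borel_calculus f S) *\<^sub>V x) x)"
    if x: "norm x = 1" for x
  proof -
    have "Re (cinner (borel_calculus f S *\<^sub>V x) x) \<le> Re (cinner (?R *\<^sub>V x) x)
        + Re (cinner ((borel_calculus C S * S) *\<^sub>V x) x
          - cinner (S *\<^sub>V x) x * cinner (borel_calculus C S *\<^sub>V x) x)"
      using tangent[of _ x] S_J x
      by (intro tangent_integral_bound S_sa f_admissible S_J C_admissible x) auto
    also have "Re (cinner ((borel_calculus C S * S) *\<^sub>V x) x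
          - cinner (S *\<^sub>V x) x * cinner (borel_calculus C S *\<^sub>V x) x) \<le> \<zeta>"
      unfolding \<zeta> using x by (intro cSup_upper covariance_bdd_above) blast
    finally show ?thesis
      using x by (simp add: bop_simps cinner_add_left cinner_diff_left scaleC_of_real
          cinner_scaleR_left Re_cinner_self)
  qed
  from Re_quadratic_form_nonneg_of_unit[OF this]
  have "positive_op (?R + complex_of_real \<zeta> *\<^sub>C 1 - borel_calculus f S)"
    unfolding positive_op_def by (intro conjI allI self_adjoint_minus R_sa f_S_sa)
  then show ?thesis
    using R_sa f_S_sa by (simp add: op_le_def)
qed

end
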